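(* Let $G$ be a group and $X(G)$ its Sidki double. If $X(G)$ is torsion-free and $\mathbb{C}(G\times G\times G)$ satisfies the weak Bass Trace Conjecture, then $\mathbb{C}X(G)$ satisfies the weak Bass Trace Conjecture too.
   Context: Sidki double: let $G$ be a group, $G^\psi$ a disjoint copy of $G$ and $\psi:G\to G^\psi$ an isomorphism, written $g\mapsto g^\psi$. With $[x,y]=x^{-1}y^{-1}xy$, the Sidki double of $G$ is the group $X(G)=\langle G, G^\psi \mid [g,g^\psi],\ g\in G\rangle$. Traces: for a group $H$ and a matrix $A=(a_{ij})\in M_n(\mathbb{C}H)$ with $a_{ij}=\sum_{h\in H}a_{ij}(h)\cdot h$, $a_{ij}(h)\in\mathbb{C}$, the Kaplansky trace is $\kappa(A)=\sum_{1\le i\le n}a_{ii}(e)$ and the augmentation trace is $\epsilon(A)=\sum_{h\in H}\sum_{1\le i\le n}a_{ii}(h)$. For a torsion-free group $H$, one says that $\mathbb{C}H$ satisfies the weak Bass Trace Conjecture if $\kappa(A)=\epsilon(A)$ for every $n\ge 1$ and every idempotent matrix $A=A^2\in M_n(\mathbb{C}H)$. (If $X(G)$ is torsion-free then so is $G$, since $G$ is a retract of $X(G)$, and hence so is $G\times G\times G$.) *)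

theory Defs
  imports
    Complex_Main
    "HOL-Library.Poly_Mapping"
    "HOL-Library.Product_Plus"
    "Jordan_Normal_Form.Matrix"
begin

text \<open>
  Groups are types of class \<^class>\<open>group_add\<close>, which does not assume commutativity: the group
  law is written \<open>+\<close>, the neutral element \<open>0\<close> and the inverse of \<open>x\<close> is \<open>- x\<close>.
\<close>

subsection \<open>The Sidki double\<close>

text \<open>
  A word over \<open>'a + 'a\<close> is a product of letters \<open>Inl g\<close> (the element \<open>g\<close> of \<open>G\<close>) and \<open>Inr g\<close>
  (the element \<open>g\<^sup>\<psi>\<close> of the disjoint copy). The relations are those of \<open>G\<close> and of its copy,
  together with the commutators \<open>[g, g\<^sup>\<psi>] = g\<^sup>-\<^sup>1 (g\<^sup>\<psi>)\<^sup>-\<^sup>1 g g\<^sup>\<psi>\<close>, and \<open>sidki_eq\<close> is the congruence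
  they generate. No formal inverses of letters are needed, because \<open>Inl (- g)\<close> and \<open>Inr (- g)\<close>
  are inverse to \<open>Inl g\<close> and \<open>Inr g\<close>.
\<close>

inductive sidki_eq :: "('a::group_add + 'a) list \<Rightarrow> ('a + 'a) list \<Rightarrow> bool" where
  refl: "sidki_eq u u"
| sym: "sidki_eq u v \<Longrightarrow> sidki_eq v u"
| trans: "sidki_eq u v \<Longrightarrow> sidki_eq v w \<Longrightarrow> sidki_eq u w"
| append: "sidki_eq u v \<Longrightarrow> sidki_eq u' v' \<Longrightarrow> sidki_eq (u @ u') (v @ v')"
| left_zero: "sidki_eq [Inl 0] []"
| left_add: "sidki_eq [Inl g, Inl h] [Inl (g + h)]"
| right_zero: "sidki_eq [Inr 0] []"
| right_add: "sidki_eq [Inr g, Inr h] [Inr (g + h)]"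
| commutator: "sidki_eq [Inl (- g), Inr (- g), Inl g, Inr g] []"

quotient_type (overloaded) 'a sidki = "('a::group_add + 'a) list" / sidki_eq
  by (intro equivpI reflpI sympI transpI) (blast intro: sidki_eq.intros)+

definition letter_inv :: "'a::group_add + 'a \<Rightarrow> 'a + 'a" where
  "letter_inv = map_sum uminus uminus"

definition word_inv :: "('a::group_add + 'a) list \<Rightarrow> ('a + 'a) list" where
  "word_inv w = rev (map letter_inv w)"

lemma letter_inv_right: "sidki_eq [x, letter_inv x] []"
proof (cases x)
  case (Inl g)
  show ?thesis
    using sidki_eq.trans[OF sidki_eq.left_add[of g "- g"]] sidki_eq.left_zero
    by (simp add: Inl letter_inv_def)
next
  case (Inr g)
  show ?thesis
    using sidki_eq.trans[OF sidki_eq.right_add[of g "- g"]] sidki_eq.right_zero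
    by (simp add: Inr letter_inv_def)
qed

lemma letter_inv_letter_inv [simp]: "letter_inv (letter_inv x) = x"
  by (cases x) (simp_all add: letter_inv_def)

lemma word_inv_word_inv [simp]: "word_inv (word_inv w) = w"
  by (simp add: word_inv_def rev_map comp_def)

lemma word_inv_right: "sidki_eq (w @ word_inv w) []"
proof (induction w)
  case Nil
  show ?case by (simp add: word_inv_def sidki_eq.refl)
next
  case (Cons x w)
  have "sidki_eq ([x] @ (w @ word_inv w) @ [letter_inv x]) ([x] @ [] @ [letter_inv x])"
    by (intro sidki_eq.append sidki_eq.refl Cons.IH)
  with letter_inv_right[of x] show ?case
    by (auto simp: word_inv_def intro: sidki_eq.trans)
qed

lemma word_inv_left: "sidki_eq (word_inv w @ w) []"
  using word_inv_right[of "word_inv w"] by simp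

lemma word_inv_cong:
  assumes "sidki_eq u v"
  shows "sidki_eq (word_inv u) (word_inv v)"
proof -
  have "sidki_eq (word_inv u @ (v @ word_inv v)) (word_inv u @ [])"
    by (intro sidki_eq.append sidki_eq.refl word_inv_right)
  moreover have "sidki_eq ((word_inv u @ u) @ word_inv v) ([] @ word_inv v)"
    by (intro sidki_eq.append sidki_eq.refl word_inv_left)
  moreover have "sidki_eq (word_inv u @ (u @ word_inv v)) (word_inv u @ (v @ word_inv v))"
    by (intro sidki_eq.append sidki_eq.refl assms)
  ultimately show ?thesis
    by simp (meson sidki_eq.sym sidki_eq.trans)
qed

instantiation sidki :: (group_add) group_add
begin

lift_definition zero_sidki :: "'a sidki" is "[]" .

lift_definition plus_sidki :: "'a sidki \<Rightarrow> 'a sidki \<Rightarrow> 'a sidki" is "(@)"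
  by (rule sidki_eq.append)

lift_definition uminus_sidki :: "'a sidki \<Rightarrow> 'a sidki" is word_inv
  by (rule word_inv_cong)

definition minus_sidki :: "'a sidki \<Rightarrow> 'a sidki \<Rightarrow> 'a sidki" where
  "minus_sidki x y = x + (- y)"

instance
proof
  fix x y z :: "'a sidki"
  show "x + y + z = x + (y + z)" by transfer (simp add: sidki_eq.refl)
  show "0 + x = x" by transfer (simp add: sidki_eq.refl)
  show "x + 0 = x" by transfer (simp add: sidki_eq.refl)
  show "- x + x = 0" by transfer (rule word_inv_left)
  show "x + (- y) = x - y" by (simp add: minus_sidki_def)
qed

end

lift_definition sidki_left :: "'a::group_add \<Rightarrow> 'a sidki" is "\<lambda>g. [Inl g]" .

lift_definition sidki_right :: "'a::group_add \<Rightarrow> 'a sidki" is "\<lambda>g. [Inr g]" .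

lemma sidki_left_add: "sidki_left (g + h) = sidki_left g + sidki_left h"
  by transfer (simp add: sidki_eq.left_add sidki_eq.sym)

lemma sidki_right_add: "sidki_right (g + h) = sidki_right g + sidki_right h"
  by transfer (simp add: sidki_eq.right_add sidki_eq.sym)

lemma sidki_commutator:
  "- sidki_left g + - sidki_right g + sidki_left g + sidki_right g = 0"
  by transfer (simp add: word_inv_def letter_inv_def sidki_eq.commutator)

text \<open>The universal property of the presentation.\<close>

lemma sidki_universal:
  fixes f f' :: "'a::group_add \<Rightarrow> 'k::group_add"
  assumes f: "\<And>g h. f (g + h) = f g + f h"
    and f': "\<And>g h. f' (g + h) = f' g + f' h"
    and c: "\<And>g. - f g + - f' g + f g + f' g = 0"
  shows "\<exists>!F. (\<forall>x y. F (x + y) = F x + F y) \<and>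
    (\<forall>g. F (sidki_left g) = f g) \<and> (\<forall>g. F (sidki_right g) = f' g)"
proof -
  define ev where "ev w = sum_list (map (case_sum f f') w)" for w
  have f0: "f 0 = 0" "f' 0 = 0"
    using f[of 0 0] f'[of 0 0] by (metis add.right_neutral add_left_cancel)+
  have fm: "f (- g) = - f g" "f' (- g) = - f' g" for g
    using f[of "- g" g] f'[of "- g" g] f0 by (simp_all add: eq_neg_iff_add_eq_0)
  have ev: "ev u = ev v" if "sidki_eq u v" for u v
    using that
  proof (induction rule: sidki_eq.induct)
    case (commutator g)
    then show ?case using c[of g] by (simp add: ev_def fm add.assoc del: add_uminus_conv_diff)
  qed (simp_all add: ev_def f f' f0)
  define F where "F x = ev (rep_sidki x)" for x
  have F_abs: "F (abs_sidki w) = ev w" for w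
    unfolding F_def by (rule ev) (rule Quotient3_rep_abs[OF Quotient3_sidki sidki_eq.refl])
  have F_add: "F (x + y) = F x + F y" for x y
  proof -
    obtain u v where "x = abs_sidki u" "y = abs_sidki v"
      by (metis Quotient3_abs_rep[OF Quotient3_sidki])
    then show ?thesis by (simp add: plus_sidki.abs_eq F_abs ev_def)
  qed
  have F_gen: "F (sidki_left g) = f g" "F (sidki_right g) = f' g" for g
    by (simp_all add: sidki_left.abs_eq sidki_right.abs_eq F_abs ev_def)
  have uniq: "F' = F"
    if F': "\<And>x y. F' (x + y) = F' x + F' y" "\<And>g. F' (sidki_left g) = f g"
      "\<And>g. F' (sidki_right g) = f' g" for F'
  proof
    fix x
    have 0: "F' 0 = 0" using F'(1)[of 0 0] by (metis add.right_neutral add_left_cancel)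
    have "F' (abs_sidki w) = ev w" for w
    proof (induction w)
      case Nil
      then show ?case using 0 by (simp add: zero_sidki.abs_eq ev_def)
    next
      case (Cons a w)
      have "abs_sidki (a # w) = abs_sidki [a] + abs_sidki w"
        by (simp add: plus_sidki.abs_eq)
      moreover have "F' (abs_sidki [a]) = case_sum f f' a"
        using F'(2,3) by (cases a) (simp_all add: sidki_left.abs_eq sidki_right.abs_eq)
      ultimately show ?case using Cons F'(1) by (simp add: ev_def)
    qed
    then show "F' x = F x"
      by (metis F_abs Quotient3_abs_rep[OF Quotient3_sidki])
  qed
  show ?thesis
  proof (rule ex1I[of _ F])
    show "(\<forall>x y. F (x + y) = F x + F y) \<and> (\<forall>g. F (sidki_left g) = f g) \<and>
        (\<forall>g. F (sidki_right g) = f' g)"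
      using F_add F_gen by blast
  qed (use uniq in blast)
qed

subsection \<open>Traces and the weak Bass Trace Conjecture\<close>

text \<open>
  The group ring \<open>\<complex>H\<close> is the type \<open>'h \<Rightarrow>\<^sub>0 complex\<close> of finitely supported functions with the
  convolution product; \<open>Poly_Mapping.lookup a h\<close> is the coefficient of \<open>h\<close> in \<open>a\<close>. \<open>Sum_any\<close> is the sum
  over all elements of the group of a function of finite support.
\<close>

definition kaplansky_trace :: "('h::group_add \<Rightarrow>\<^sub>0 complex) mat \<Rightarrow> complex" where
  "kaplansky_trace A = (\<Sum>i<dim_row A. Poly_Mapping.lookup (A $$ (i, i)) 0)"

definition augmentation_trace :: "('h::group_add \<Rightarrow>\<^sub>0 complex) mat \<Rightarrow> complex" where
  "augmentation_trace A = Sum_any (\<lambda>h. \<Sum>i<dim_row A. Poly_Mapping.lookup (A $$ (i, i)) h)"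

definition torsion_free :: "'h::group_add itself \<Rightarrow> bool" where
  "torsion_free _ \<longleftrightarrow> (\<forall>(x::'h) n. n > 0 \<longrightarrow> sum_list (replicate n x) = 0 \<longrightarrow> x = 0)"

definition weak_bass :: "'h::group_add itself \<Rightarrow> bool" where
  "weak_bass _ \<longleftrightarrow>
    (\<forall>n\<ge>1. \<forall>A \<in> carrier_mat n n :: ('h \<Rightarrow>\<^sub>0 complex) mat set.
      A * A = A \<longrightarrow> kaplansky_trace A = augmentation_trace A)"

end

theory Submission
  imports Defs "HOL-Computational_Algebra.Polynomial" "HOL-Computational_Algebra.Primes"
    "HOL-Library.FuncSet" "HOL-Library.Multiset"
begin

text \<open>
  Let \<open>\<rho> : X(G) \<rightarrow> G \<times> G \<times> G\<close> send \<open>g\<close> to \<open>(g, g, 1)\<close> and \<open>g\<^sup>\<psi>\<close> to \<open>(1, g, g)\<close>, with kernel \<open>W\<close>.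
  Let \<open>D = [G, G\<^sup>\<psi>]\<close> and let \<open>L\<close> be the normal subgroup generated by the \<open>g\<^sup>-\<^sup>1 g\<^sup>\<psi>\<close>.
  Since \<open>W\<close> lies in \<open>L \<inter> D\<close>, where \<open>[L, D] = 1\<close> and \<open>X(G)/LD\<close> is abelian, any two elements of
  \<open>X(G)\<close> have commuting conjugation actions on \<open>W\<close>. Applying the hypothesis to the image of an
  idempotent \<open>A\<close> under \<open>\<rho>\<close>, the augmentation trace of \<open>A\<close> is the sum over \<open>W\<close> of the coefficients of
  the diagonal of \<open>A\<close>, so it suffices that the partial trace of \<open>A\<close> over the conjugacy class of each
  nontrivial \<open>w \<in> W\<close> vanishes; conjugacy is taken in the subgroup \<open>K\<close> generated by the support
  of \<open>A\<close>. Suppose it is \<open>b \<noteq> 0\<close>. The coefficients of \<open>A\<close> generate a ring \<open>S\<close> in which \<open>b\<close> is divisible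
  by only finitely many primes. For every other prime \<open>p\<close>, expanding \<open>A = A\<^sup>q\<close> with \<open>q\<close> a power of \<open>p\<close> and
  rotating the factors cyclically shows that modulo \<open>p\<close> only \<open>q\<close>-th powers of elements of the support
  contribute, so for every \<open>q\<close> some element of the support has a \<open>q\<close>-th power conjugate to \<open>w\<close>. Two
  different \<open>q\<close> share such an element, and \<open>w\<close> is conjugate in \<open>K\<close> to some power of exponent \<open>p\<^sup>n\<close>
  with \<open>n > 0\<close> of itself. But \<open>K\<close> acts on \<open>W\<close> through a finitely generated abelian group,
  whereas the numbers \<open>p\<^sup>n\<close> for infinitely many \<open>p\<close> are multiplicatively
  independent and \<open>W\<close> is torsion-free.
\<close>

section \<open>Finitely generated rings modulo primes\<close>

definition is_subring :: "'a::comm_ring_1 set \<Rightarrow> bool" where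
  "is_subring S \<longleftrightarrow> 1 \<in> S \<and> (\<forall>a\<in>S. \<forall>b\<in>S. a - b \<in> S \<and> a * b \<in> S)"

lemma is_subringD:
  assumes "is_subring S"
  shows "1 \<in> S" "0 \<in> S" "a \<in> S \<Longrightarrow> b \<in> S \<Longrightarrow> a - b \<in> S" "a \<in> S \<Longrightarrow> b \<in> S \<Longrightarrow> a * b \<in> S"
    "a \<in> S \<Longrightarrow> - a \<in> S" "a \<in> S \<Longrightarrow> b \<in> S \<Longrightarrow> a + b \<in> S"
proof -
  show 1: "1 \<in> S" and m: "a \<in> S \<Longrightarrow> b \<in> S \<Longrightarrow> a - b \<in> S" "a \<in> S \<Longrightarrow> b \<in> S \<Longrightarrow> a * b \<in> S" for a b
    using assms by (auto simp: is_subring_def)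
  show 0: "0 \<in> S" using m(1)[OF 1 1] by simp
  show n: "a \<in> S \<Longrightarrow> - a \<in> S" for a using m(1)[OF 0, of a] by simp
  show "a \<in> S \<Longrightarrow> b \<in> S \<Longrightarrow> a + b \<in> S" using m(1)[of a "- b"] n[of b] by simp
qed

lemma is_subring_sum: "is_subring S \<Longrightarrow> (\<And>x. x \<in> T \<Longrightarrow> f x \<in> S) \<Longrightarrow> sum f T \<in> S"
  by (induction T rule: infinite_finite_induct) (auto intro: is_subringD)

lemma is_subring_power: "is_subring S \<Longrightarrow> a \<in> S \<Longrightarrow> a ^ k \<in> S"
  by (induction k) (auto intro: is_subringD)

lemma is_subring_of_nat: "is_subring S \<Longrightarrow> of_nat k \<in> S"
  by (induction k) (auto intro: is_subringD)

lemma is_subring_prod_list: "is_subring S \<Longrightarrow> set xs \<subseteq> S \<Longrightarrow> prod_list xs \<in> S"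
  by (induction xs) (auto intro: is_subringD)

section \<open>Polynomials over a subring and pseudo-division\<close>

definition polys_over :: "'a::comm_ring_1 set \<Rightarrow> 'a poly set" where
  "polys_over S = {f. \<forall>i. coeff f i \<in> S}"

lemma is_subring_polys_over:
  assumes "is_subring S"
  shows "is_subring (polys_over S)"
  unfolding is_subring_def[of "polys_over S"] unfolding polys_over_def
  by (auto simp: coeff_mult coeff_1 is_subringD(1,2)[OF assms] intro!: is_subring_sum[OF assms] is_subringD(3,4)[OF assms])

lemma polys_over_intros:
  assumes "is_subring S"
  shows "a \<in> S \<Longrightarrow> monom a k \<in> polys_over S"
    and "a \<in> S \<Longrightarrow> [:a:] \<in> polys_over S"
    and "a \<in> S \<Longrightarrow> f \<in> polys_over S \<Longrightarrow> smult a f \<in> polys_over S"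
  using is_subringD[OF assms]
  by (auto simp: polys_over_def coeff_pCons split: nat.split)

definition adjoin :: "'a::comm_ring_1 set \<Rightarrow> 'a \<Rightarrow> 'a set" where
  "adjoin S x = (\<lambda>f. poly f x) ` polys_over S"

lemma is_subring_adjoin:
  assumes S: "is_subring S"
  shows "is_subring (adjoin S x)"
proof -
  note P = is_subringD[OF is_subring_polys_over[OF S]]
  have "1 \<in> adjoin S x"
    unfolding adjoin_def using P(1) by (rule rev_image_eqI) simp
  moreover have "poly f x - poly g x \<in> adjoin S x" "poly f x * poly g x \<in> adjoin S x"
    if "f \<in> polys_over S" "g \<in> polys_over S" for f g
    unfolding adjoin_def using P(3,4)[OF that] by (metis image_eqI poly_diff, metis image_eqI poly_mult)
  ultimately show ?thesis unfolding is_subring_def adjoin_def by blast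
qed

lemma subset_adjoin: "is_subring S \<Longrightarrow> insert x S \<subseteq> adjoin S x"
proof -
  assume S: "is_subring S"
  have "x \<in> adjoin S x"
    unfolding adjoin_def using polys_over_intros(1)[OF S is_subringD(1)[OF S], of 1]
    by (rule rev_image_eqI) (simp add: poly_monom)
  moreover have "a \<in> adjoin S x" if "a \<in> S" for a
    unfolding adjoin_def using polys_over_intros(2)[OF S that] by (rule rev_image_eqI) simp
  ultimately show ?thesis by blast
qed

text \<open>\<open>S\<close> need not be a field, so \<open>f\<close> is first scaled by the leading
  coefficient of \<open>g\<close>; the leading term can then be cancelled within \<open>S\<close>,
  and the scalings accumulate in \<open>e\<close>.\<close>

lemma pseudo_division_over:
  fixes g :: "'a::idom poly"
  assumes S: "is_subring S" and g: "g \<in> polys_over S" "g \<noteq> 0" and f: "f \<in> polys_over S"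
  shows "\<exists>e q r. q \<in> polys_over S \<and> r \<in> polys_over S \<and>
    smult (lead_coeff g ^ e) f = q * g + r \<and> (r = 0 \<or> degree r < degree g)"
  using f
proof (induction "degree f" arbitrary: f rule: less_induct)
  case less
  note P = is_subringD[OF is_subring_polys_over[OF S]]
  let ?l = "lead_coeff g"
  have l: "?l \<in> S" "lead_coeff f \<in> S" using g less.prems by (auto simp: polys_over_def)
  show ?case
  proof (cases "f = 0 \<or> degree f < degree g")
    case True
    then show ?thesis
      using less.prems P(2) by (intro exI[of _ 0] exI[of _ f]) auto
  next
    case False
    define t where "t = monom (lead_coeff f) (degree f - degree g)"
    define f' where "f' = smult ?l f - t * g"
    have t: "t \<in> polys_over S" unfolding t_def by (rule polys_over_intros(1)[OF S l(2)])
    have f': "f' \<in> polys_over S"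
      unfolding f'_def by (intro P t g polys_over_intros(3)[OF S] l less.prems)
    have "lead_coeff f \<noteq> 0" "?l \<noteq> 0" using False g by auto
    have deg_tg: "degree (t * g) = degree f"
      using False g by (simp add: t_def degree_mult_eq degree_monom_eq monom_eq_0_iff)
    have "degree f' \<le> degree f"
      unfolding f'_def by (rule degree_diff_le) (simp_all add: deg_tg degree_smult_le)
    moreover have "coeff f' (degree f) = 0"
      using False by (simp add: f'_def t_def coeff_monom_mult)
    ultimately have dec: "f' = 0 \<or> degree f' < degree f"
      by (metis leading_coeff_0_iff le_neq_implies_less)
    have "\<exists>e q r. q \<in> polys_over S \<and> r \<in> polys_over S \<and>
      smult (?l ^ e) f' = q * g + r \<and> (r = 0 \<or> degree r < degree g)"
    proof (cases "f' = 0")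
      case True
      then show ?thesis using P(2) by (intro exI[of _ 0]) simp
    qed (use dec less.hyps f' in blast)
    then obtain e q r where r: "q \<in> polys_over S" "r \<in> polys_over S"
      "smult (?l ^ e) f' = q * g + r" "r = 0 \<or> degree r < degree g" by blast
    have "smult (?l ^ Suc e) f = smult (?l ^ e) (f' + t * g)" by (simp add: f'_def mult.commute)
    also have "\<dots> = (q + smult (?l ^ e) t) * g + r"
      using r(3) by (simp add: smult_add_right algebra_simps)
    finally show ?thesis
      using r P(6)[OF r(1) polys_over_intros(3)[OF S is_subring_power[OF S l(1)] t]] by blast
  qed
qed

text \<open>
  Nilpotence modulo \<open>p\<close>, rather than divisibility by \<open>p\<close>, is the condition that behaves well when a
  generator is adjoined.
\<close>

definition nilp_primes :: "'a::comm_ring_1 set \<Rightarrow> 'a \<Rightarrow> nat set" where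
  "nilp_primes S a = {p. prime p \<and> (\<exists>k. \<exists>s\<in>S. a ^ k = of_nat p * s)}"

text \<open>Transcendence of \<open>x\<close> turns a relation \<open>a ^ k = p * y\<close> into an
  identity of polynomials over \<open>S\<close>, whose leading coefficients give the same kind of
  relation in \<open>S\<close>.\<close>

lemma nilp_primes_adjoin_transcendental:
  fixes x :: "'a::idom"
  assumes S: "is_subring S" and fin: "\<And>a. a \<in> S \<Longrightarrow> a \<noteq> 0 \<Longrightarrow> finite (nilp_primes S a)"
    and tr: "\<And>f. f \<in> polys_over S \<Longrightarrow> poly f x = 0 \<Longrightarrow> f = 0"
    and a: "a \<in> adjoin S x" "a \<noteq> 0"
  shows "finite (nilp_primes (adjoin S x) a)"
proof -
  note P = is_subringD[OF is_subring_polys_over[OF S]]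
  obtain f where f: "f \<in> polys_over S" "a = poly f x" using a by (auto simp: adjoin_def)
  have "f \<noteq> 0" using f a by auto
  have "nilp_primes (adjoin S x) a \<subseteq> nilp_primes S (lead_coeff f)"
  proof
    fix p assume "p \<in> nilp_primes (adjoin S x) a"
    then obtain k y where p: "prime p" and y: "y \<in> polys_over S" "a ^ k = of_nat p * poly y x"
      by (auto simp: nilp_primes_def adjoin_def)
    have "f ^ k - smult (of_nat p) y = 0"
      by (rule tr) (use y f S in \<open>auto intro!: P is_subring_power is_subring_polys_over
        polys_over_intros is_subring_of_nat\<close>)
    then have "lead_coeff (f ^ k) = of_nat p * coeff y (degree (f ^ k))" by simp
    then show "p \<in> nilp_primes S (lead_coeff f)"
      using p y by (auto simp: nilp_primes_def lead_coeff_power polys_over_def)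
  qed
  then show ?thesis using fin[of "lead_coeff f"] \<open>f \<noteq> 0\<close> f
    by (auto simp: polys_over_def intro: finite_subset)
qed

text \<open>Euclidean descent: among the nonzero multiples of \<open>a\<close> that are values
  \<open>h(x)\<close> with \<open>degree h < degree m\<close>, one of least degree comes from a
  constant \<open>h\<close>, because pseudo-dividing \<open>m\<close> by a nonconstant
  \<open>h\<close> would yield a smaller one.\<close>

lemma algebraic_multiple_in_base:
  fixes x :: "'a::idom"
  assumes S: "is_subring S" and m: "m \<in> polys_over S" "m \<noteq> 0" "poly m x = 0"
    and min: "\<And>h. h \<in> polys_over S \<Longrightarrow> h \<noteq> 0 \<Longrightarrow> degree h < degree m \<Longrightarrow> poly h x \<noteq> 0"
    and a: "a \<in> adjoin S x" "a \<noteq> 0"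
  shows "\<exists>g\<in>polys_over S. a * poly g x \<in> S - {0}"
proof -
  note P = is_subringD[OF is_subring_polys_over[OF S]]
  obtain f where f: "f \<in> polys_over S" "a = poly f x" using a by (auto simp: adjoin_def)
  define Q where "Q d \<longleftrightarrow> (\<exists>h\<in>polys_over S. \<exists>g\<in>polys_over S. degree h = d \<and> degree h < degree m \<and>
    poly h x \<noteq> 0 \<and> poly h x = a * poly g x)" for d
  obtain e q r where r: "q \<in> polys_over S" "r \<in> polys_over S"
    "smult (lead_coeff m ^ e) f = q * m + r" "r = 0 \<or> degree r < degree m"
    using pseudo_division_over[OF S m(1,2) f(1)] by blast
  have "poly r x = lead_coeff m ^ e * a"
    using arg_cong[OF r(3), of "\<lambda>f. poly f x"] m(3) f(2) by simp
  moreover have "[:lead_coeff m ^ e:] \<in> polys_over S"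
    using m(1) by (intro polys_over_intros S is_subring_power) (auto simp: polys_over_def)
  ultimately have "Q (degree r)"
    unfolding Q_def using r a m(2)
    by (intro bexI[of _ r] bexI[of _ "[:lead_coeff m ^ e:]"]) (auto simp: mult.commute)
  then obtain d where d: "Q d" "\<And>d'. d' < d \<Longrightarrow> \<not> Q d'"
    by (metis exists_least_iff)
  obtain h g where h: "h \<in> polys_over S" "g \<in> polys_over S" "degree h = d" "degree h < degree m"
    "poly h x \<noteq> 0" "poly h x = a * poly g x" using d(1) by (auto simp: Q_def)
  have h0: "h \<noteq> 0" using h(5) by auto
  have "d = 0"
  proof (rule ccontr)
    assume "d \<noteq> 0"
    obtain e q r where r: "q \<in> polys_over S" "r \<in> polys_over S"
      "smult (lead_coeff h ^ e) m = q * h + r" "r = 0 \<or> degree r < degree h"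
      using pseudo_division_over[OF S h(1) h0 m(1)] by blast
    have e0: "lead_coeff h ^ e \<noteq> 0" using h0 by simp
    have rx: "poly r x = a * poly (- q * g) x"
      using arg_cong[OF r(3), of "\<lambda>f. poly f x"] m(3) h(6)
      by (simp add: algebra_simps eq_neg_iff_add_eq_0)
    \<comment> \<open>Otherwise \<open>x\<close> would be a root of the factor \<open>q\<close>,
      whose degree is below that of \<open>m\<close> since \<open>d > 0\<close>, against
      \<open>min\<close>.\<close>
    have r0: "r \<noteq> 0"
    proof
      assume "r = 0"
      then have qh: "smult (lead_coeff h ^ e) m = q * h" using r(3) by simp
      then have "q \<noteq> 0" using m(2) e0 by (metis mult_zero_left smult_eq_0_iff)
      have "degree m = degree q + degree h"
        using arg_cong[OF qh, of degree] \<open>q \<noteq> 0\<close> h0 e0 by (simp add: degree_mult_eq)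
      then have "degree q < degree m" using \<open>d \<noteq> 0\<close> h(3) by simp
      moreover have "poly q x = 0"
        using arg_cong[OF qh, of "\<lambda>f. poly f x"] m(3) h(5) by simp
      ultimately show False using min r(1) \<open>q \<noteq> 0\<close> by blast
    qed
    have "Q (degree r)" unfolding Q_def
    proof (intro bexI conjI)
      show "poly r x = a * poly (- q * g) x" by (rule rx)
      show "poly r x \<noteq> 0" using r r0 h by (intro min) auto
      show "- q * g \<in> polys_over S" using r h by (intro P)
    qed (use r r0 h in auto)
    then show False using d(2) r(4) r0 h(3) by blast
  qed
  then have "poly h x = coeff h 0" using h(3) degree_eq_zeroE[of h] by force
  then have "a * poly g x \<in> S - {0}" using h by (auto simp: polys_over_def)
  then show ?thesis using h(2) by blast
qed

text \<open>Some nonzero multiple \<open>b = a * g(x)\<close> lies in \<open>S\<close>, and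
  \<open>a ^ k = p * y\<close> implies \<open>b ^ k = p * y * g(x) ^ k\<close>. Reducing the right
  side modulo an annihilator \<open>m\<close> of least degree costs powers of its leading
  coefficient \<open>c\<close> and leaves a relation in \<open>S\<close>, so only primes attached to
  \<open>c * b\<close> occur.\<close>

lemma nilp_primes_adjoin_algebraic:
  fixes x :: "'a::idom"
  assumes S: "is_subring S" and fin: "\<And>a. a \<in> S \<Longrightarrow> a \<noteq> 0 \<Longrightarrow> finite (nilp_primes S a)"
    and m: "m \<in> polys_over S" "m \<noteq> 0" "poly m x = 0"
    and a: "a \<in> adjoin S x" "a \<noteq> 0"
  shows "finite (nilp_primes (adjoin S x) a)"
proof -
  note P = is_subringD[OF is_subring_polys_over[OF S]]
  obtain n where "\<exists>m\<in>polys_over S. m \<noteq> 0 \<and> poly m x = 0 \<and> degree m = n"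
    and least: "\<And>n'. n' < n \<Longrightarrow> \<not> (\<exists>m\<in>polys_over S. m \<noteq> 0 \<and> poly m x = 0 \<and> degree m = n')"
    using m exists_least_iff[of "\<lambda>n. \<exists>m\<in>polys_over S. m \<noteq> 0 \<and> poly m x = 0 \<and> degree m = n"] by auto
  then obtain m where m: "m \<in> polys_over S" "m \<noteq> 0" "poly m x = 0"
    and min: "\<And>h. h \<in> polys_over S \<Longrightarrow> h \<noteq> 0 \<Longrightarrow> degree h < degree m \<Longrightarrow> poly h x \<noteq> 0"
    by blast
  obtain g where g: "g \<in> polys_over S" "a * poly g x \<in> S" "a * poly g x \<noteq> 0"
    using algebraic_multiple_in_base[OF S m min a] by blast
  define b c where "b = a * poly g x" and "c = lead_coeff m"
  have bc: "b \<in> S" "c \<in> S" "b \<noteq> 0" "c \<noteq> 0" using g m by (auto simp: b_def c_def polys_over_def)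
  have deg_m: "0 < degree m"
    using m degree_eq_zeroE[of m] by (intro gr0I) force
  have "nilp_primes (adjoin S x) a \<subseteq> nilp_primes S (c * b)"
  proof
    fix p assume "p \<in> nilp_primes (adjoin S x) a"
    then obtain k y where p: "prime p" and y: "y \<in> polys_over S" "a ^ k = of_nat p * poly y x"
      by (auto simp: nilp_primes_def adjoin_def)
    have "y * g ^ k \<in> polys_over S"
      using y g by (intro P is_subring_power is_subring_polys_over S)
    then obtain e q r where r: "q \<in> polys_over S" "r \<in> polys_over S"
      "smult (c ^ e) (y * g ^ k) = q * m + r" "r = 0 \<or> degree r < degree m"
      using pseudo_division_over[OF S m(1,2)] unfolding c_def by blast
    \<comment> \<open>\<open>h\<close> vanishes at \<open>x\<close> in degree below that of
      \<open>m\<close>, hence is zero; its constant coefficient is the wanted relation in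
      \<open>S\<close>.\<close>
    define h where "h = [:c ^ e * b ^ k:] - smult (of_nat p) r"
    have "poly r x = c ^ e * (poly y x * poly g x ^ k)"
      using arg_cong[OF r(3), of "\<lambda>f. poly f x"] m(3) by simp
    then have "poly h x = 0" by (simp add: h_def b_def power_mult_distrib y(2) ac_simps)
    moreover have "h \<in> polys_over S"
      unfolding h_def using bc r(2) S
      by (intro P polys_over_intros is_subringD(4)[OF S] is_subring_power is_subring_of_nat)
    moreover have "degree h < degree m"
      unfolding h_def using deg_m r(4) degree_smult_le[of "of_nat p" r]
      by (intro degree_diff_less) auto
    ultimately have "h = 0" using min by blast
    moreover have "coeff h 0 = c ^ e * b ^ k - of_nat p * coeff r 0" by (simp add: h_def)
    ultimately have "c ^ e * b ^ k = of_nat p * coeff r 0" by simp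
    \<comment> \<open>Multiplying by \<open>c ^ k * b ^ e\<close> equalizes the two exponents, as no
      bound on \<open>e\<close> is available.\<close>
    then have "(c * b) ^ (e + k) = of_nat p * (coeff r 0 * (c ^ k * b ^ e))"
      by (simp add: power_add power_mult_distrib)
    moreover have "coeff r 0 * (c ^ k * b ^ e) \<in> S"
      using r(2) bc S by (intro is_subringD(4) is_subring_power) (auto simp: polys_over_def)
    ultimately show "p \<in> nilp_primes S (c * b)" using p by (auto simp: nilp_primes_def)
  qed
  moreover have "c * b \<in> S" "c * b \<noteq> 0" using bc is_subringD(4)[OF S] by auto
  ultimately show ?thesis using fin finite_subset by blast
qed

text \<open>Start from the integers, where a prime dividing a power of \<open>z\<close> divides
  \<open>z\<close>, and adjoin the elements of \<open>E\<close> one at a time.\<close>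

lemma finitely_generated_subring_nilp_primes:
  fixes E :: "'a::{idom, ring_char_0} set"
  assumes "finite E"
  shows "\<exists>S. is_subring S \<and> E \<subseteq> S \<and> (\<forall>a\<in>S. a \<noteq> 0 \<longrightarrow> finite (nilp_primes S a))"
  using assms
proof (induction E)
  case empty
  have "finite (nilp_primes \<int> (of_int z :: 'a))" if "z \<noteq> 0" for z
  proof -
    have "nilp_primes \<int> (of_int z :: 'a) \<subseteq> {p. p dvd nat \<bar>z\<bar>}"
    proof
      fix p assume "p \<in> nilp_primes \<int> (of_int z :: 'a)"
      then obtain k y where p: "prime p" "(of_int z :: 'a) ^ k = of_nat p * of_int y"
        by (auto simp: nilp_primes_def Ints_def)
      then have "(of_int (z ^ k) :: 'a) = of_int (int p * y)" by simp
      then have "z ^ k = int p * y" by (simp only: of_int_eq_iff)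
      then have "int p dvd z ^ k" by simp
      then have "int p dvd z" using p(1) prime_dvd_power[of "int p"] by simp
      then show "p \<in> {p. p dvd nat \<bar>z\<bar>}" by (simp add: nat_dvd_iff int_dvd_int_iff [symmetric])
    qed
    then show ?thesis using that finite_divisors_nat[of "nat \<bar>z\<bar>"] by (simp add: finite_subset)
  qed
  moreover have "is_subring (\<int> :: 'a set)" by (simp add: is_subring_def)
  ultimately show ?case by (intro exI[of _ \<int>]) (auto elim!: Ints_cases)
next
  case (insert x E)
  then obtain S where S: "is_subring S" "E \<subseteq> S" "\<forall>a\<in>S. a \<noteq> 0 \<longrightarrow> finite (nilp_primes S a)" by blast
  have "finite (nilp_primes (adjoin S x) a)" if "a \<in> adjoin S x" "a \<noteq> 0" for a
  proof (cases "\<exists>m\<in>polys_over S. m \<noteq> 0 \<and> poly m x = 0")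
    case True
    then show ?thesis using nilp_primes_adjoin_algebraic[of S _ x a] S that by blast
  next
    case False
    then show ?thesis using nilp_primes_adjoin_transcendental[of S x a] S that by blast
  qed
  then show ?case
    using is_subring_adjoin[OF S(1), of x] subset_adjoin[OF S(1), of x] S(2)
    by (intro exI[of _ "adjoin S x"]) auto
qed

section \<open>Traces of idempotents modulo primes\<close>

lemma iterate_invariant: "(\<And>x. x \<in> T \<Longrightarrow> \<sigma> x \<in> T) \<Longrightarrow> x \<in> T \<Longrightarrow> (\<sigma> ^^ k) x \<in> T"
  by (induction k) auto

lemma iterate_period:
  assumes "(\<sigma> ^^ m) x = x"
  shows "(\<sigma> ^^ (m * k)) x = x"
  by (induction k) (simp_all add: assms funpow_add)

text \<open>With \<open>i * a = p * b + 1\<close> from Bezout, both \<open>i * a\<close> and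
  \<open>p * b\<close> steps return to \<open>x\<close>, and they differ by one step.\<close>

lemma prime_period_fixed:
  assumes p: "prime p" "(\<sigma> ^^ p) x = x" and i: "(\<sigma> ^^ i) x = x" "0 < i" "i < p"
  shows "\<sigma> x = x"
proof -
  have "coprime i p" using p(1) i(2,3) by (metis coprime_commute nat_dvd_not_less prime_imp_coprime)
  then obtain a b where "i * a = p * b + 1"
    using i(2) coprime_bezout_strong[of i p] p(1) prime_gt_1_nat[of p]
    by (metis nat_neq_iff)
  then have "(\<sigma> ^^ (i * a)) x = \<sigma> ((\<sigma> ^^ (p * b)) x)" by simp
  then show ?thesis using iterate_period[OF i(1)] iterate_period[OF p(2)] by simp
qed

text \<open>An orbit that is not a fixed point has exactly \<open>p\<close> elements and
  \<open>f\<close> is constant on it, so it contributes a multiple of \<open>p\<close>. Such orbits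
  are removed one by one.\<close>

lemma sum_prime_period:
  fixes f :: "'b \<Rightarrow> 'a::comm_ring_1"
  assumes S: "is_subring S" and p: "prime p"
    and "finite T" "\<And>x. x \<in> T \<Longrightarrow> \<sigma> x \<in> T" "\<And>x. x \<in> T \<Longrightarrow> (\<sigma> ^^ p) x = x"
    "\<And>x. x \<in> T \<Longrightarrow> f (\<sigma> x) = f x" "\<And>x. x \<in> T \<Longrightarrow> f x \<in> S"
  shows "\<exists>s\<in>S. sum f T = sum f {x \<in> T. \<sigma> x = x} + of_nat p * s"
  using assms(3-)
proof (induction "card T" arbitrary: T rule: less_induct)
  case less
  note inv = iterate_invariant[of T \<sigma>, OF less.prems(2)]
  show ?case
  proof (cases "\<forall>x\<in>T. \<sigma> x = x")
    case True
    then have "{x \<in> T. \<sigma> x = x} = T" by auto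
    then show ?thesis using is_subringD(2)[OF S] by (intro bexI[of _ 0]) simp_all
  next
    case False
    then obtain x where x: "x \<in> T" "\<sigma> x \<noteq> x" by blast
    define orb where "orb = (\<lambda>i. (\<sigma> ^^ i) x) ` {..<p}"
    have per: "(\<sigma> ^^ p) y = y" if "y \<in> T" for y using less.prems(3) that .
    have p0: "0 < p" using p prime_gt_0_nat by blast
    have orb_T: "orb \<subseteq> T" using inv x by (auto simp: orb_def)
    \<comment> \<open>A coincidence among these iterates would be a period strictly between 0 and
      \<open>p\<close>.\<close>
    have inj_aux: "(\<sigma> ^^ i) x \<noteq> (\<sigma> ^^ j) x" if "i < j" "j < p" for i j
    proof
      assume eq: "(\<sigma> ^^ i) x = (\<sigma> ^^ j) x"
      have "(\<sigma> ^^ (p - j + i)) x = (\<sigma> ^^ (p - j)) ((\<sigma> ^^ j) x)"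
        by (simp add: funpow_add eq)
      also have "\<dots> = (\<sigma> ^^ (p - j + j)) x" by (simp only: funpow_add comp_apply)
      also have "\<dots> = (\<sigma> ^^ p) x" using that by simp
      finally have "(\<sigma> ^^ (p - j + i)) x = x" using per x(1) by simp
      moreover have "0 < p - j + i" "p - j + i < p" using that by linarith+
      ultimately have "\<sigma> x = x" by (rule prime_period_fixed[OF p per[OF x(1)]])
      then show False using x(2) by simp
    qed
    have "inj_on (\<lambda>i. (\<sigma> ^^ i) x) {..<p}"
      by (rule inj_onI) (metis inj_aux lessThan_iff nat_neq_iff)
    moreover have f_orb: "f ((\<sigma> ^^ i) x) = f x" for i
      by (induction i) (simp_all add: less.prems(4) inv x)
    ultimately have sum_orb: "sum f orb = of_nat p * f x"
      unfolding orb_def by (simp add: sum.reindex)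
    have orb_\<sigma>: "\<sigma> y \<in> orb" if "y \<in> orb" for y
    proof -
      obtain i where i: "i < p" "y = (\<sigma> ^^ i) x" using \<open>y \<in> orb\<close> by (auto simp: orb_def)
      show ?thesis
      proof (cases "Suc i = p")
        case True
        then have "\<sigma> y = (\<sigma> ^^ 0) x" using per[OF x(1)] i by auto
        then show ?thesis using p0 unfolding orb_def by blast
      next
        case False
        then have "Suc i < p" "\<sigma> y = (\<sigma> ^^ Suc i) x" using i by auto
        then show ?thesis unfolding orb_def by blast
      qed
    qed
    \<comment> \<open>\<open>\<sigma>\<close> is undone by its iterate \<open>p - 1\<close>, so the
      complement of the orbit is again closed under \<open>\<sigma>\<close>.\<close>
    have orb_back: "y \<in> orb" if "y \<in> T" "\<sigma> y \<in> orb" for y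
    proof -
      have "(\<sigma> ^^ (p - 1)) (\<sigma> y) \<in> orb" by (rule iterate_invariant[OF orb_\<sigma> that(2)])
      moreover have "(\<sigma> ^^ (p - 1)) (\<sigma> y) = (\<sigma> ^^ p) y"
        using p0 by (metis Suc_diff_1 comp_apply funpow_Suc_right)
      ultimately show ?thesis using per that by simp
    qed
    have no_fix: "\<sigma> y \<noteq> y" if "y \<in> orb" for y
    proof
      assume fixd: "\<sigma> y = y"
      obtain i where i: "i < p" "y = (\<sigma> ^^ i) x" using \<open>y \<in> orb\<close> by (auto simp: orb_def)
      have "(\<sigma> ^^ k) y = y" for k by (induction k) (simp_all add: fixd)
      then have "y = (\<sigma> ^^ (p - i)) y" by metis
      also have "\<dots> = (\<sigma> ^^ (p - i + i)) x" by (simp only: i(2) funpow_add comp_apply)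
      also have "\<dots> = (\<sigma> ^^ p) x" using i(1) by simp
      finally show False using per[OF x(1)] x(2) fixd by simp
    qed
    define T' where "T' = T - orb"
    have "\<exists>s\<in>S. sum f T' = sum f {x \<in> T'. \<sigma> x = x} + of_nat p * s"
    proof (rule less.hyps)
      have "x \<in> orb" unfolding orb_def using p0 by (intro image_eqI[of _ _ 0]) auto
      then show "card T' < card T"
        unfolding T'_def using x less.prems(1) by (intro psubset_card_mono) auto
    qed (use less.prems orb_back in \<open>auto simp: T'_def\<close>)
    then obtain s where s: "s \<in> S" "sum f T' = sum f {x \<in> T'. \<sigma> x = x} + of_nat p * s" by blast
    have "{x \<in> T'. \<sigma> x = x} = {x \<in> T. \<sigma> x = x}" using no_fix by (auto simp: T'_def)
    moreover have "sum f T = sum f T' + sum f orb"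
      unfolding T'_def using orb_T less.prems(1) by (rule sum.subset_diff)
    ultimately show ?thesis
      using s less.prems(5)[OF x(1)] is_subringD(6)[OF S] sum_orb
      by (intro bexI[of _ "s + f x"]) (simp_all add: algebra_simps)
  qed
qed

text \<open>Induction through \<open>\<tau> = \<sigma> ^^ (p ^ m)\<close>: it has period
  \<open>p\<close> on \<open>T\<close>, and on its fixed points \<open>\<sigma>\<close> has period
  \<open>p ^ m\<close>.\<close>

lemma sum_prime_power_period:
  fixes f :: "'b \<Rightarrow> 'a::comm_ring_1"
  assumes S: "is_subring S" and p: "prime p"
    and "finite T" "\<And>x. x \<in> T \<Longrightarrow> \<sigma> x \<in> T" "\<And>x. x \<in> T \<Longrightarrow> (\<sigma> ^^ (p ^ m)) x = x"
    "\<And>x. x \<in> T \<Longrightarrow> f (\<sigma> x) = f x" "\<And>x. x \<in> T \<Longrightarrow> f x \<in> S"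
  shows "\<exists>s\<in>S. sum f T = sum f {x \<in> T. \<sigma> x = x} + of_nat p * s"
  using assms(3-)
proof (induction m arbitrary: T)
  case 0
  then have "{x \<in> T. \<sigma> x = x} = T" by auto
  then show ?case using is_subringD(2)[OF S] by (intro bexI[of _ 0]) simp_all
next
  case (Suc m)
  define \<tau> where "\<tau> = \<sigma> ^^ (p ^ m)"
  define T' where "T' = {x \<in> T. \<tau> x = x}"
  note inv = iterate_invariant[of T \<sigma>, OF Suc.prems(2)]
  have "f ((\<sigma> ^^ k) x) = f x" if "x \<in> T" for k x
    using that by (induction k) (simp_all add: Suc.prems(4) inv)
  moreover have "(\<tau> ^^ p) x = x" if "x \<in> T" for x
    using Suc.prems(3)[OF that] by (simp add: \<tau>_def funpow_mult mult.commute)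
  ultimately have "\<exists>s\<in>S. sum f T = sum f {x \<in> T. \<tau> x = x} + of_nat p * s"
    using Suc.prems by (intro sum_prime_period[OF S p]) (simp_all add: \<tau>_def inv)
  then obtain s where s: "s \<in> S" "sum f T = sum f T' + of_nat p * s" by (auto simp: T'_def)
  have "\<tau> (\<sigma> x) = \<sigma> (\<tau> x)" for x by (simp add: \<tau>_def funpow_swap1)
  then have "\<exists>s\<in>S. sum f T' = sum f {x \<in> T'. \<sigma> x = x} + of_nat p * s"
    using Suc.prems by (intro Suc.IH) (auto simp: T'_def \<tau>_def)
  then obtain s' where s': "s' \<in> S" "sum f T' = sum f {x \<in> T'. \<sigma> x = x} + of_nat p * s'" by blast
  have "(\<sigma> ^^ k) x = x" if "\<sigma> x = x" for k x using that by (induction k) simp_all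
  then have "{x \<in> T'. \<sigma> x = x} = {x \<in> T. \<sigma> x = x}" by (auto simp: T'_def \<tau>_def)
  then show ?case
    using s s' is_subringD(6)[OF S] by (intro bexI[of _ "s + s'"]) (simp_all add: algebra_simps)
qed

lemma rotate1_fixed_replicate:
  assumes "rotate1 xs = xs"
  shows "\<exists>x. xs = replicate (length xs) x"
proof (cases xs)
  case (Cons x ys)
  have "\<forall>y\<in>set ys. y = x" if "ys @ [x] = x # ys" for ys
    using that by (induction ys) auto
  then have "\<forall>y\<in>set xs. y = x" using assms Cons by simp
  then show ?thesis by (metis replicate_length_same)
qed simp

section \<open>Words of elementary matrices and powers of an idempotent\<close>

definition words :: "'b set \<Rightarrow> nat \<Rightarrow> 'b list set" where
  "words I m = {xs. set xs \<subseteq> I \<and> length xs = m}"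

lemma finite_words: "finite I \<Longrightarrow> finite (words I m)"
  unfolding words_def by (rule finite_lists_length_eq)

lemma words_0 [simp]: "words I 0 = {[]}"
  by (auto simp: words_def)

lemma sum_words_Suc:
  "(\<Sum>xs\<in>words I (Suc m). f xs) = (\<Sum>s\<in>I. \<Sum>xs\<in>words I m. f (s # xs))"
proof -
  have "(\<Sum>xs\<in>words I (Suc m). f xs) = (\<Sum>(s, xs)\<in>I \<times> words I m. f (s # xs))"
    by (rule sum.reindex_bij_witness[of _ "\<lambda>(s, xs). s # xs" "\<lambda>xs. (hd xs, tl xs)"])
      (auto simp: words_def length_Suc_conv)
  then show ?thesis by (simp add: sum.cartesian_product)
qed

text \<open>
  A list of triples \<open>(u, v, g)\<close> encodes a product of elementary matrices \<open>g E\<^sub>u\<^sub>v\<close>; it is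
  nonzero precisely when the triples form a path.
\<close>

fun path :: "nat \<Rightarrow> (nat \<times> nat \<times> 'h) list \<Rightarrow> nat \<Rightarrow> bool" where
  "path i [] j \<longleftrightarrow> i = j"
| "path i ((u, v, g) # xs) j \<longleftrightarrow> u = i \<and> path v xs j"

text \<open>When a matrix power is expanded, a path contributes the coefficient
  \<open>weight\<close> at the group element \<open>label\<close>.\<close>

definition label :: "(nat \<times> nat \<times> 'h::monoid_add) list \<Rightarrow> 'h" where
  "label xs = sum_list (map (\<lambda>(u, v, g). g) xs)"

definition weight :: "(nat \<Rightarrow> nat \<Rightarrow> 'h \<Rightarrow> 'a::comm_ring_1) \<Rightarrow> (nat \<times> nat \<times> 'h) list \<Rightarrow> 'a" where
  "weight a xs = prod_list (map (\<lambda>(u, v, g). a u v g) xs)"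

lemma label_simps [simp]: "label [] = 0" "label ((u, v, g) # xs) = g + label xs"
    "label (xs @ ys) = label xs + label ys"
  by (simp_all add: label_def)

lemma weight_simps [simp]: "weight a [] = 1" "weight a ((u, v, g) # xs) = a u v g * weight a xs"
    "weight a (xs @ ys) = weight a xs * weight a ys"
  by (simp_all add: weight_def)

lemma path_append: "path i (xs @ ys) j \<longleftrightarrow> (\<exists>k. path i xs k \<and> path k ys j)"
  by (induction i xs j rule: path.induct) auto

text \<open>This is \<open>A = A ^ (m + 1)\<close> written out, each use of idempotence splitting
  off a first letter. The length is \<open>Suc m\<close> since words of length 0 describe the
  identity matrix.\<close>

lemma idempotent_entries_words:
  fixes a :: "nat \<Rightarrow> nat \<Rightarrow> 'h::group_add \<Rightarrow> 'a::comm_ring_1"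
  assumes F: "finite F" "\<And>i j g. i < n \<Longrightarrow> j < n \<Longrightarrow> g \<notin> F \<Longrightarrow> a i j g = 0"
    and idem: "\<And>i j g. i < n \<Longrightarrow> j < n \<Longrightarrow> a i j g = (\<Sum>k<n. \<Sum>h\<in>F. a i k h * a k j (- h + g))"
    and ij: "i < n" "j < n"
  shows "a i j g = (\<Sum>xs\<in>words ({..<n} \<times> {..<n} \<times> F) (Suc m).
    if path i xs j \<and> label xs = g then weight a xs else 0)"
  using ij
proof (induction m arbitrary: i g)
  case 0
  have "(\<Sum>xs\<in>words ({..<n} \<times> {..<n} \<times> F) (Suc 0).
      if path i xs j \<and> label xs = g then weight a xs else 0) =
    (\<Sum>s\<in>{..<n} \<times> {..<n} \<times> F. if s = (i, j, g) then a i j g else 0)"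
    unfolding sum_words_Suc words_0 by (intro sum.cong) auto
  also have "\<dots> = a i j g" using 0 F by (simp add: sum.delta)
  finally show ?case ..
next
  case (Suc m)
  let ?I = "{..<n} \<times> {..<n} \<times> F"
  have label_eq: "h + l = g \<longleftrightarrow> l = - h + g" for h l by (metis add_minus_cancel minus_add_cancel)
  have "(\<Sum>xs\<in>words ?I (Suc (Suc m)). if path i xs j \<and> label xs = g then weight a xs else 0) =
    (\<Sum>(u, v, h)\<in>?I. \<Sum>xs\<in>words ?I (Suc m).
      if u = i \<and> path v xs j \<and> label xs = - h + g then a u v h * weight a xs else 0)"
    unfolding sum_words_Suc[of _ _ "Suc m"]
    by (intro sum.cong) (auto intro!: sum.cong simp: label_eq)
  also have "\<dots> = (\<Sum>(u, v, h)\<in>?I. if u = i then a u v h * (\<Sum>xs\<in>words ?I (Suc m).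
      if path v xs j \<and> label xs = - h + g then weight a xs else 0) else 0)"
    by (intro sum.cong) (auto simp: sum_distrib_left intro!: sum.cong sum.neutral)
  also have "\<dots> = (\<Sum>(u, v, h)\<in>?I. if u = i then a u v h * a v j (- h + g) else 0)"
    using Suc.IH Suc.prems(2) by (intro sum.cong) auto
  also have "\<dots> = (\<Sum>u<n. \<Sum>v<n. \<Sum>h\<in>F. if u = i then a u v h * a v j (- h + g) else 0)"
    by (simp add: sum.cartesian_product)
  also have "\<dots> = (\<Sum>u<n. if u = i then \<Sum>v<n. \<Sum>h\<in>F. a i v h * a v j (- h + g) else 0)"
    by (intro sum.cong) auto
  also have "\<dots> = a i j g" using Suc.prems by (simp add: idem[of i j])
  finally show ?case ..
qed

text \<open>The partial trace is a sum over closed paths of length \<open>p ^ m\<close> with label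
  in \<open>c\<close>. Rotation preserves closedness, weight and, by \<open>c\<close>, this
  condition on the label. So modulo \<open>p\<close> only constant words remain, and
  \<open>no_root\<close> excludes their labels.\<close>

lemma idempotent_class_trace_divisible:
  fixes a :: "nat \<Rightarrow> nat \<Rightarrow> 'h::group_add \<Rightarrow> 'a::comm_ring_1"
  assumes F: "finite F" "\<And>i j g. i < n \<Longrightarrow> j < n \<Longrightarrow> g \<notin> F \<Longrightarrow> a i j g = 0"
    and idem: "\<And>i j g. i < n \<Longrightarrow> j < n \<Longrightarrow> a i j g = (\<Sum>k<n. \<Sum>h\<in>F. a i k h * a k j (- h + g))"
    and S: "is_subring S" "\<And>i j g. i < n \<Longrightarrow> j < n \<Longrightarrow> a i j g \<in> S"
    and c: "\<And>g h. g \<in> F \<Longrightarrow> g + h \<in> c \<longleftrightarrow> h + g \<in> c"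
    and p: "prime p" and no_root: "\<And>g. g \<in> F \<Longrightarrow> sum_list (replicate (p ^ m) g) \<notin> c"
  shows "\<exists>s\<in>S. (\<Sum>i<n. \<Sum>g\<in>c \<inter> F. a i i g) = of_nat p * s"
proof -
  define I where "I = {..<n} \<times> {..<n} \<times> F"
  define T where "T = words I (p ^ m)"
  \<comment> \<open>Summing over all base points \<open>i\<close> makes \<open>f\<close> insensitive
    to where a closed path starts.\<close>
  define f where "f xs = (\<Sum>i<n. if path i xs i \<and> label xs \<in> c then weight a xs else 0)" for xs
  have "finite I" using F(1) by (simp add: I_def)
  then have finT: "finite T" by (simp add: T_def finite_words)
  obtain q where q: "p ^ m = Suc q" using p prime_gt_0_nat by (metis gr0_conv_Suc zero_less_power)
  \<comment> \<open>\<open>F\<close> may miss labels of long words; with \<open>G\<close> the sum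
    over \<open>g\<close> collapses to the test \<open>label xs \<in> c\<close>.\<close>
  define G where "G = F \<union> label ` T"
  have finG: "finite G" using F(1) finT by (simp add: G_def)
  have "(\<Sum>i<n. \<Sum>g\<in>c \<inter> F. a i i g) = (\<Sum>i<n. \<Sum>g\<in>c \<inter> G. a i i g)"
    using finG F(2) by (intro sum.cong sum.mono_neutral_left) (auto simp: G_def)
  also have "\<dots> = (\<Sum>i<n. \<Sum>g\<in>c \<inter> G. \<Sum>xs\<in>T. if path i xs i \<and> label xs = g then weight a xs else 0)"
  proof (rule sum.cong[OF HOL.refl], rule sum.cong[OF HOL.refl])
    fix i g assume "i \<in> {..<n}"
    then show "a i i g = (\<Sum>xs\<in>T. if path i xs i \<and> label xs = g then weight a xs else 0)"
      unfolding T_def q I_def by (intro idempotent_entries_words F idem) auto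
  qed
  also have "\<dots> = (\<Sum>i<n. \<Sum>xs\<in>T. \<Sum>g\<in>c \<inter> G. if path i xs i \<and> label xs = g then weight a xs else 0)"
    by (intro sum.cong HOL.refl sum.swap)
  also have "\<dots> = (\<Sum>i<n. \<Sum>xs\<in>T. if path i xs i \<and> label xs \<in> c then weight a xs else 0)"
  proof (rule sum.cong[OF HOL.refl], rule sum.cong[OF HOL.refl])
    fix i xs assume "xs \<in> T"
    then have "(\<Sum>g\<in>c \<inter> G. if label xs = g then weight a xs else 0) =
        (if label xs \<in> c then weight a xs else 0)"
      using finG by (simp add: sum.delta' G_def)
    then show "(\<Sum>g\<in>c \<inter> G. if path i xs i \<and> label xs = g then weight a xs else 0) =
        (if path i xs i \<and> label xs \<in> c then weight a xs else 0)" by (cases "path i xs i") simp_all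
  qed
  also have "\<dots> = sum f T" unfolding f_def by (rule sum.swap)
  finally have tr: "(\<Sum>i<n. \<Sum>g\<in>c \<inter> F. a i i g) = sum f T" .
  have rot: "f (rotate1 xs) = f xs" if "xs \<in> T" for xs
  proof (cases xs)
    case (Cons s ys)
    obtain u v g where s: "s = (u, v, g)" by (cases s)
    have uvg: "u < n" "v < n" "g \<in> F" using that by (auto simp: Cons s T_def words_def I_def)
    have "f xs = (\<Sum>i<n. if u = i then if path v ys i \<and> g + label ys \<in> c then weight a xs else 0 else 0)"
      unfolding f_def by (intro sum.cong) (auto simp: Cons s)
    also have "\<dots> = (if path v ys u \<and> g + label ys \<in> c then weight a xs else 0)" using uvg by simp
    also have "\<dots> = (\<Sum>i<n. if v = i then if path i ys u \<and> g + label ys \<in> c then weight a xs else 0 else 0)"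
      using uvg by simp
    also have "\<dots> = f (rotate1 xs)"
      unfolding f_def by (intro sum.cong) (auto simp: Cons s path_append c[OF uvg(3)] mult.commute)
    finally show ?thesis ..
  qed simp
  have inS: "f xs \<in> S" if "xs \<in> T" for xs
  proof -
    have "weight a xs \<in> S" unfolding weight_def
      using that S(2) by (intro is_subring_prod_list[OF S(1)]) (auto simp: T_def words_def I_def)
    then show ?thesis unfolding f_def
      using is_subringD(2)[OF S(1)] by (intro is_subring_sum[OF S(1)]) simp
  qed
  have "\<exists>s\<in>S. sum f T = sum f {xs \<in> T. rotate1 xs = xs} + of_nat p * s"
  proof (rule sum_prime_power_period[OF S(1) p finT, where m = m])
    fix xs assume xs: "xs \<in> T"
    then show "rotate1 xs \<in> T" by (simp add: T_def words_def)
    show "(rotate1 ^^ p ^ m) xs = xs" using xs rotate_id[of "p ^ m" xs]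
      by (simp add: T_def words_def rotate_def)
  qed (use rot inS in auto)
  moreover have "f xs = 0" if "xs \<in> T" "rotate1 xs = xs" for xs
  proof -
    have len: "length xs = p ^ m" using that(1) by (simp add: T_def words_def)
    then obtain s where xs: "xs = replicate (p ^ m) s"
      using rotate1_fixed_replicate[OF \<open>rotate1 xs = xs\<close>] by auto
    obtain u v g where s: "s = (u, v, g)" by (cases s)
    have "s \<in> I" using that(1) xs q by (simp add: T_def words_def)
    then have "g \<in> F" by (simp add: I_def s)
    moreover have "label xs = sum_list (replicate (p ^ m) g)" by (simp add: label_def xs s)
    ultimately show ?thesis using no_root by (simp add: f_def)
  qed
  ultimately show ?thesis using tr by (auto simp: sum.neutral)
qed

section \<open>The conjugation action on the kernel\<close>

lemmas group_word = add.assoc minus_add diff_conv_add_uminus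

section \<open>Commutator identities in the Sidki double\<close>

definition conjug :: "'h::group_add \<Rightarrow> 'h \<Rightarrow> 'h" where
  "conjug x w = x + w + - x"

definition comm :: "'h::group_add \<Rightarrow> 'h \<Rightarrow> 'h" where
  "comm x y = - x + - y + x + y"

lemma sidki_lr_commute: "sidki_left g + sidki_right g = sidki_right g + sidki_left g"
proof -
  have "sidki_right g + sidki_left g + (- sidki_left g + - sidki_right g + sidki_left g + sidki_right g)
    = sidki_left g + sidki_right g"
    by (simp add: group_word del: add_uminus_conv_diff)
  then show ?thesis by (simp only: sidki_commutator add_0_right)
qed
lemma sidki_zero_neg:
  fixes g :: "'a::group_add"
  shows "sidki_left (0 :: 'a) = 0" "sidki_right (0 :: 'a) = 0"
    and "sidki_left (- g) = - sidki_left g" "sidki_right (- g) = - sidki_right g"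
proof -
  show 0: "sidki_left 0 = (0 :: 'a sidki)" "sidki_right 0 = (0 :: 'a sidki)"
    using sidki_left_add[of 0 0] sidki_right_add[of 0 0]
    by (metis add.right_neutral add_left_cancel)+
  show "sidki_left (- g) = - sidki_left g" "sidki_right (- g) = - sidki_right g"
    using sidki_left_add[of "- g" g] sidki_right_add[of "- g" g] 0
    by (simp_all add: eq_neg_iff_add_eq_0)
qed

text \<open>With \<open>A\<close>, \<open>B\<close> the copies of \<open>a\<close>,
  \<open>b\<close>, the hypotheses are the defining relations for \<open>a\<close>, \<open>b\<close>
  and their product. The third moves \<open>A + B\<close> past \<open>a + b\<close>; the other two
  allow the cancellations.\<close>

lemma comm_swap_aux:
  fixes a b A B :: "'h::group_add"
  assumes "a + A = A + a" "b + B = B + b" "a + b + (A + B) = A + B + (a + b)"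
  shows "comm A (- b) = comm a (- B)"
proof -
  have 1: "- A + b + A + B = - a + B + a + b"
  proof -
    have "- A + b + A + B = - a + - A + (a + b + (A + B))"
      using assms(1) by (metis add.assoc add_minus_cancel minus_add minus_add_cancel)
    also have "\<dots> = - a + B + a + b"
      unfolding assms(3) by (simp add: group_word del: add_uminus_conv_diff)
    finally show ?thesis .
  qed
  then have "- A + b + A = - a + B + a + b + - B" by (metis add.assoc add.right_inverse add_0_right)
  also have "b + - B = - B + b" using assms(2) by (metis add.assoc add_minus_cancel minus_add_cancel add.right_inverse add_0_right)
  then have "- a + B + a + b + - B = - a + B + a + - B + b" by (metis add.assoc)
  finally have "- A + b + A + - b = - a + B + a + - B"
    by (metis add.assoc add.right_inverse add_0_right)
  then show ?thesis by (simp add: comm_def)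
qed

lemma sidki_comm_swap:
  "comm (sidki_right g) (sidki_left h) = comm (sidki_left g) (sidki_right h)"
proof -
  have "comm (sidki_right g) (- sidki_left (- h)) = comm (sidki_left g) (- sidki_right (- h))"
    by (rule comm_swap_aux) (use sidki_lr_commute[of g] sidki_lr_commute[of "-h"]
       sidki_lr_commute[of "g + - h"] in \<open>simp_all only: sidki_left_add sidki_right_add\<close>)
  then show ?thesis by (simp add: sidki_zero_neg)
qed

lemma sidki_comm_swap':
  "comm (sidki_left g) (sidki_right h) = comm (sidki_right g) (sidki_left h)"
  using sidki_comm_swap[of g h] by simp

lemma comm_add_left: "comm (x + y) z = conjug (- y) (comm x z) + comm y z"
  by (simp add: comm_def conjug_def group_word del: add_uminus_conv_diff)

lemma comm_add_right: "comm x (y + z) = comm x z + conjug (- z) (comm x y)"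
  by (simp add: comm_def conjug_def group_word del: add_uminus_conv_diff)

lemma conjug_add: "conjug (x + y) w = conjug x (conjug y w)"
  by (simp add: conjug_def group_word del: add_uminus_conv_diff)

lemma conjug_add_right: "conjug x (v + w) = conjug x v + conjug x w"
  by (simp add: conjug_def group_word del: add_uminus_conv_diff)

lemma conjug_0 [simp]: "conjug 0 w = w" "conjug x 0 = 0"
  by (simp_all add: conjug_def)

lemma conjug_conjug_minus [simp]: "conjug x (conjug (- x) w) = w" "conjug (- x) (conjug x w) = w"
  by (simp_all flip: conjug_add)

lemma conjug_eq_self_iff: "conjug x w = w \<longleftrightarrow> x + w = w + x"
proof
  assume "conjug x w = w"
  then have "conjug x w + x = w + x" by simp
  then show "x + w = w + x" by (simp add: conjug_def add.assoc del: add_uminus_conv_diff)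
qed (simp add: conjug_def)

text \<open>Expand the swap identity for the product of \<open>h\<close> and \<open>- x\<close>:
  both sides contain the same commutators, one of them conjugated by \<open>x\<close> on one side
  and by its copy on the other.\<close>

lemma sidki_conj_comm:
  "conjug (sidki_left x) (comm (sidki_left h) (sidki_right g)) =
   conjug (sidki_right x) (comm (sidki_left h) (sidki_right g))"
proof -
  let ?l = sidki_left and ?r = sidki_right
  have "comm (?l h + ?l (- x)) (?r g) = comm (?r h + ?r (- x)) (?l g)"
    using sidki_comm_swap'[of "h + - x" g] by (simp only: sidki_left_add sidki_right_add)
  then have "conjug (- ?l (- x)) (comm (?l h) (?r g)) + comm (?l (- x)) (?r g) =
      conjug (- ?r (- x)) (comm (?r h) (?l g)) + comm (?r (- x)) (?l g)"
    by (simp only: comm_add_left)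
  then show ?thesis
    unfolding sidki_comm_swap add_right_cancel by (simp add: sidki_zero_neg)
qed

text \<open>
  The \<open>ell g\<close> generate \<open>L\<close> and the \<open>dcomm h g\<close> generate \<open>D\<close>.
\<close>

definition ell :: "'g::group_add \<Rightarrow> 'g sidki" where
  "ell g = - sidki_left g + sidki_right g"

definition dcomm :: "'g::group_add \<Rightarrow> 'g \<Rightarrow> 'g sidki" where
  "dcomm h g = comm (sidki_left h) (sidki_right g)"

lemma ell_commutes_dcomm: "ell x + dcomm h g = dcomm h g + ell x"
proof -
  have "conjug (ell x) (dcomm h g) = conjug (- sidki_left x) (conjug (sidki_right x) (dcomm h g))"
    by (simp add: ell_def conjug_add)
  also have "\<dots> = dcomm h g" by (simp add: dcomm_def flip: sidki_conj_comm)
  finally show ?thesis by (simp only: conjug_eq_self_iff)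
qed

text \<open>\<open>L\<close> and \<open>D\<close> are never formed as subgroups: as
  \<open>[L, D] = 1\<close>, membership in \<open>L\<close> is weakened to centralizing all
  \<open>dcomm h g\<close>, and membership in \<open>D\<close> to centralizing all
  \<open>ell g\<close>.\<close>

definition centralizer :: "'h::group_add set \<Rightarrow> 'h set" where
  "centralizer Y = {x. \<forall>y\<in>Y. x + y = y + x}"

lemma centralizer_closed:
  "0 \<in> centralizer Y"
  "x \<in> centralizer Y \<Longrightarrow> y \<in> centralizer Y \<Longrightarrow> x + y \<in> centralizer Y"
  "x \<in> centralizer Y \<Longrightarrow> - x \<in> centralizer Y"
proof -
  show "0 \<in> centralizer Y" by (simp add: centralizer_def)
  show "x \<in> centralizer Y \<Longrightarrow> y \<in> centralizer Y \<Longrightarrow> x + y \<in> centralizer Y"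
    by (simp add: centralizer_def) (metis add.assoc)
  have "- x + y = y + - x" if "x + y = y + x" for y
  proof -
    have "- x + y = - x + (y + x) + - x" by (simp add: add.assoc del: add_uminus_conv_diff)
    also have "\<dots> = y + - x" by (simp flip: that)
    finally show ?thesis .
  qed
  then show "x \<in> centralizer Y \<Longrightarrow> - x \<in> centralizer Y"
    by (simp add: centralizer_def)
qed

text \<open>The double centralizer of \<open>Y\<close> stands in for the subgroup generated by
  \<open>Y\<close>, and the first hypothesis for its normality.\<close>

lemma conj_centralizer:
  assumes "\<And>y. y \<in> Y \<Longrightarrow> conjug (- k) y \<in> centralizer (centralizer Y)" and x: "x \<in> centralizer Y"
  shows "conjug k x \<in> centralizer Y"
  unfolding centralizer_def
proof (intro CollectI ballI)
  fix y assume "y \<in> Y"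
  then have "x + conjug (- k) y = conjug (- k) y + x"
    using assms unfolding centralizer_def by (metis (mono_tags, lifting) mem_Collect_eq)
  then have "conjug k (x + conjug (- k) y) = conjug k (conjug (- k) y + x)" by simp
  then show "conjug k x + y = y + conjug k x" by (simp add: conjug_add_right)
qed

lemma centralizer_centralizer_base: "Y \<subseteq> centralizer (centralizer Y)"
  by (auto simp: centralizer_def)

text \<open>Conjugates of generators of \<open>L\<close> by letters are again products of generators
  and their inverses.\<close>

lemma conjug_ell:
  "conjug (- sidki_left h) (ell g) = ell (g + h) + - ell h"
  "conjug (- sidki_right h) (ell g) = conjug (- ell h) (conjug (- sidki_left h) (ell g))"
proof -
  show 1: "conjug (- sidki_left h) (ell g) = ell (g + h) + - ell h"
    by (simp add: conjug_def ell_def sidki_left_add sidki_right_add group_word del: add_uminus_conv_diff)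
  show "conjug (- sidki_right h) (ell g) = conjug (- ell h) (conjug (- sidki_left h) (ell g))"
    by (simp add: conjug_def ell_def group_word del: add_uminus_conv_diff)
qed

definition conj_stable :: "'g::group_add sidki set \<Rightarrow> bool" where
  "conj_stable Z \<longleftrightarrow> (\<forall>z\<in>Z. \<forall>h. conjug (sidki_left h) z \<in> Z \<and> conjug (sidki_right h) z \<in> Z)"

lemma conj_stable_ell: "conj_stable (centralizer (range ell))"
  unfolding conj_stable_def
proof (intro ballI allI conjI)
  fix z :: "'a sidki" and h assume z: "z \<in> centralizer (range ell)"
  let ?CC = "centralizer (centralizer (range ell)) :: 'a sidki set"
  have e: "ell g \<in> ?CC" for g using centralizer_centralizer_base by blast
  have l: "conjug (- sidki_left h) (ell g) \<in> ?CC" for g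
    unfolding conjug_ell(1) by (intro centralizer_closed e)
  have r: "conjug (- sidki_right h) (ell g) \<in> ?CC" for g
    unfolding conjug_ell(2) conjug_def[of "- ell h"] by (intro centralizer_closed e l)
  show "conjug (sidki_left h) z \<in> centralizer (range ell)" by (rule conj_centralizer[OF _ z]) (use l in blast)
  show "conjug (sidki_right h) z \<in> centralizer (range ell)" by (rule conj_centralizer[OF _ z]) (use r in blast)
qed

lemma conj_stable_dcomm: "conj_stable (centralizer (range (case_prod dcomm)))"
  unfolding conj_stable_def
proof (intro ballI allI conjI)
  fix z :: "'a sidki" and h assume z: "z \<in> centralizer (range (case_prod dcomm))"
  let ?CC = "centralizer (centralizer (range (case_prod dcomm))) :: 'a sidki set"
  have e: "dcomm g k \<in> ?CC" for g k :: 'a using centralizer_centralizer_base by fast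
  have "conjug (- sidki_left h) (dcomm g k) = dcomm (g + h) k + - dcomm h k" for g k :: 'a
    by (simp add: dcomm_def sidki_left_add comm_add_left add.assoc del: add_uminus_conv_diff)
  then have l: "conjug (- sidki_left h) (dcomm g k) \<in> ?CC" for g k :: 'a
    by (simp only:) (intro centralizer_closed e)
  have "conjug (- sidki_right h) (dcomm g k) = - dcomm g h + dcomm g (k + h)" for g k :: 'a
    by (simp add: dcomm_def sidki_right_add comm_add_right flip: add.assoc del: add_uminus_conv_diff)
  then have r: "conjug (- sidki_right h) (dcomm g k) \<in> ?CC" for g k :: 'a
    by (simp only:) (intro centralizer_closed e)
  show "conjug (sidki_left h) z \<in> centralizer (range (case_prod dcomm))"
    by (rule conj_centralizer[OF _ z]) (use l in fast)
  show "conjug (sidki_right h) z \<in> centralizer (range (case_prod dcomm))"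
    by (rule conj_centralizer[OF _ z]) (use r in fast)
qed

section \<open>Homomorphisms from the Sidki double and the kernel \<open>W\<close>\<close>

lemma sidki_induct:
  assumes "P 0" "\<And>x g. P x \<Longrightarrow> P (x + sidki_left g)" "\<And>x g. P x \<Longrightarrow> P (x + sidki_right g)"
  shows "P (x :: 'g::group_add sidki)"
proof -
  have "P (abs_sidki w)" for w :: "('g + 'g) list"
  proof (induction w rule: rev_induct)
    case Nil
    then show ?case using assms(1) by (simp add: zero_sidki.abs_eq)
  next
    case (snoc a w)
    have "abs_sidki (w @ [a]) = abs_sidki w + abs_sidki [a]" by (simp add: plus_sidki.abs_eq)
    then show ?case using assms(2,3) snoc
      by (cases a) (simp_all add: sidki_left.abs_eq sidki_right.abs_eq)
  qed
  then show ?thesis by (metis Quotient3_abs_rep[OF Quotient3_sidki])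
qed

lemma group_add_hom_iff: "group_add_hom f \<longleftrightarrow> (\<forall>x y. f (x + y) = f x + f y)"
proof
  assume add: "\<forall>x y. f (x + y) = f x + f y"
  then have "f 0 + f 0 = f 0 + 0" by (metis add.right_neutral)
  then have "f 0 = 0" by (simp only: add_left_cancel)
  then show "group_add_hom f" using add by unfold_locales simp_all
qed (simp add: group_add_hom.axioms plus_hom.hom_add monoid_add_hom.axioms semigroup_add_hom.axioms)

lemma group_add_hom_simps:
  assumes "group_add_hom f"
  shows "f (x + y) = f x + f y" "f 0 = 0" "f (- x) = - f x"
proof -
  interpret group_add_hom f by fact
  show "f (x + y) = f x + f y" "f 0 = 0" "f (- x) = - f x" by (simp_all add: hom_add hom_uminus)
qed

lemma sidki_hom:
  fixes f f' :: "'g::group_add \<Rightarrow> 'k::group_add"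
  assumes "group_add_hom f" "group_add_hom f'" "\<And>g. f g + f' g = f' g + f g"
  shows "\<exists>F. group_add_hom F \<and> (\<forall>g. F (sidki_left g) = f g \<and> F (sidki_right g) = f' g)"
proof -
  have "- f g + - f' g + f g + f' g = 0" for g
    by (simp add: add.assoc assms(3)[of g] del: add_uminus_conv_diff)
  then show ?thesis
    using sidki_universal[of f f'] assms(1,2) unfolding group_add_hom_iff by blast
qed

text \<open>\<open>F\<close> identifies the two copies, so \<open>x\<close> differs from
  \<open>F x\<close> in the left copy by an element of \<open>L\<close>. Appending a letter
  conjugates this difference and, for a right letter, also multiplies it by
  \<open>ell g\<close>.\<close>

lemma sidki_decompose_middle:
  assumes F: "group_add_hom F" "\<And>g. F (sidki_left g) = g" "\<And>g. F (sidki_right g) = g"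
  shows "- sidki_left (F x) + x \<in> centralizer (range (case_prod dcomm))"
proof (induction x rule: sidki_induct)
  let ?Z = "centralizer (range (case_prod dcomm)) :: 'a sidki set"
  case 1 show ?case by (simp add: group_add_hom_simps[OF F(1)] sidki_zero_neg centralizer_closed)
next
  case (2 x g)
  have "conjug (- sidki_left g) (- sidki_left (F x) + x) \<in> centralizer (range (case_prod dcomm))"
    using conj_stable_dcomm 2 unfolding conj_stable_def by (metis sidki_zero_neg(3))
  then show ?case
    by (simp add: group_add_hom_simps[OF F(1)] F sidki_left_add conjug_def group_word del: add_uminus_conv_diff)
next
  case (3 x g)
  have "conjug (- sidki_right g) (- sidki_left (F x) + x) \<in> centralizer (range (case_prod dcomm))"
    using conj_stable_dcomm 3 unfolding conj_stable_def by (metis sidki_zero_neg(4))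
  moreover have "ell g \<in> centralizer (range (case_prod dcomm))"
    by (auto simp: centralizer_def ell_commutes_dcomm)
  ultimately have "ell g + conjug (- sidki_right g) (- sidki_left (F x) + x)
    \<in> centralizer (range (case_prod dcomm))" by (intro centralizer_closed)
  then show ?case
    by (simp add: group_add_hom_simps[OF F(1)] F ell_def sidki_left_add conjug_def group_word del: add_uminus_conv_diff)
qed

text \<open>\<open>F\<close> and \<open>H\<close> together have kernel \<open>D\<close>. Appending a
  left letter requires moving it past \<open>H x\<close> in the right copy, which costs the inverse
  of \<open>dcomm g (H x)\<close>.\<close>

lemma sidki_decompose_outer:
  assumes F: "group_add_hom F" "\<And>g. F (sidki_left g) = g" "\<And>g. F (sidki_right g) = 0"
    and H: "group_add_hom H" "\<And>g. H (sidki_left g) = 0" "\<And>g. H (sidki_right g) = g"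
  shows "- sidki_right (H x) + - sidki_left (F x) + x \<in> centralizer (range ell)"
proof (induction x rule: sidki_induct)
  case 1 show ?case
    by (simp add: group_add_hom_simps[OF F(1)] group_add_hom_simps[OF H(1)] sidki_zero_neg centralizer_closed)
next
  case (2 x g)
  let ?z = "- sidki_right (H x) + - sidki_left (F x) + x"
  have "conjug (- sidki_left g) ?z \<in> centralizer (range ell)"
    using conj_stable_ell 2 unfolding conj_stable_def by (metis sidki_zero_neg(3))
  moreover have "dcomm g (H x) \<in> centralizer (range ell)"
    by (auto simp: centralizer_def ell_commutes_dcomm)
  ultimately have "- dcomm g (H x) + conjug (- sidki_left g) ?z \<in> centralizer (range ell)"
    by (intro centralizer_closed)
  then show ?case
    by (simp add: group_add_hom_simps[OF F(1)] group_add_hom_simps[OF H(1)] F H sidki_left_add dcomm_def comm_def conjug_def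
      group_word del: add_uminus_conv_diff)
next
  case (3 x g)
  have "conjug (- sidki_right g) (- sidki_right (H x) + - sidki_left (F x) + x) \<in> centralizer (range ell)"
    using conj_stable_ell 3 unfolding conj_stable_def by (metis sidki_zero_neg(4))
  then show ?case
    by (simp add: group_add_hom_simps[OF F(1)] group_add_hom_simps[OF H(1)] F H sidki_right_add conjug_def
      group_word del: add_uminus_conv_diff)
qed

lemma sidki_hom_to_triple:
  "\<exists>\<rho> :: 'g::group_add sidki \<Rightarrow> 'g \<times> 'g \<times> 'g. group_add_hom \<rho> \<and>
    (\<forall>w x y. \<rho> w = 0 \<longrightarrow> conjug x (conjug y w) = conjug y (conjug x w))"
proof -
  obtain \<rho> :: "'g sidki \<Rightarrow> 'g \<times> 'g \<times> 'g" where \<rho>: "group_add_hom \<rho>"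
    "\<And>g. \<rho> (sidki_left g) = (g, g, 0)" "\<And>g. \<rho> (sidki_right g) = (0, g, g)"
    using sidki_hom[of "\<lambda>g. (g, g, 0 :: 'g)" "\<lambda>g. (0 :: 'g, g, g)"] by (auto simp: group_add_hom_iff)
  define W where "W = {w. \<rho> w = 0}"
  have W_conj: "conjug x w \<in> W" if "w \<in> W" for x w
    using that by (simp add: W_def conjug_def group_add_hom_simps[OF \<rho>(1)] del: add_uminus_conv_diff)
  have homs: "group_add_hom (\<lambda>x. fst (\<rho> x))" "group_add_hom (\<lambda>x. fst (snd (\<rho> x)))" "group_add_hom (\<lambda>x. snd (snd (\<rho> x)))"
    by (auto simp: group_add_hom_iff group_add_hom_simps[OF \<rho>(1)])
  \<comment> \<open>The vanishing middle component will show that \<open>w\<close> centralizes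
    \<open>D\<close>, the two outer ones that it centralizes \<open>L\<close>.\<close>
  have comps: "fst (\<rho> w) = 0" "fst (snd (\<rho> w)) = 0" "snd (snd (\<rho> w)) = 0" if "w \<in> W" for w
    using that by (auto simp: W_def)
  have dc: "conjug (dcomm h g) w = w" if "w \<in> W" for w g h
  proof -
    have "w \<in> centralizer (range (case_prod dcomm))"
      using sidki_decompose_middle[OF homs(2), of w] \<rho> comps[OF that] by (simp add: sidki_zero_neg)
    then have "w + dcomm h g = dcomm h g + w" unfolding centralizer_def by auto
    then show ?thesis by (simp add: conjug_eq_self_iff)
  qed
  have el: "conjug (ell g) w = w" if "w \<in> W" for w g
  proof -
    have "w \<in> centralizer (range ell)"
      using sidki_decompose_outer[OF homs(1) _ _ homs(3), of w] \<rho> comps[OF that]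
      by (simp add: sidki_zero_neg)
    then have "w + ell g = ell g + w" unfolding centralizer_def by auto
    then show ?thesis by (simp add: conjug_eq_self_iff)
  qed
  have lr: "conjug (sidki_right g) w = conjug (sidki_left g) w" if "w \<in> W" for w g
    using arg_cong[OF el[OF that], of "conjug (sidki_left g)" g] by (simp add: ell_def conjug_add)
  \<comment> \<open>As \<open>dcomm g h\<close> acts trivially, the actions of \<open>g\<close> and
    of the copy of \<open>h\<close> commute; by \<open>lr\<close> that copy acts like
    \<open>h\<close>.\<close>
  have ll: "conjug (sidki_left g) (conjug (sidki_left h) w) = conjug (sidki_left h) (conjug (sidki_left g) w)"
    if "w \<in> W" for w g h
  proof -
    have "conjug (sidki_left g) (conjug (sidki_right h) w) = conjug (sidki_right h + sidki_left g) (conjug (dcomm g h) w)"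
      by (simp add: dcomm_def comm_def group_word flip: conjug_add del: add_uminus_conv_diff)
    also have "\<dots> = conjug (sidki_right h) (conjug (sidki_left g) w)" by (simp add: dc that conjug_add)
    finally show ?thesis using that by (simp add: lr W_conj)
  qed
  \<comment> \<open>Both copies act alike on \<open>W\<close>, so \<open>x\<close> acts through the
    product of its letters with the copies identified, which is the middle component of
    \<open>\<rho>\<close>.\<close>
  define \<pi> where "\<pi> x = fst (snd (\<rho> x))" for x
  have pi: "conjug x w = conjug (sidki_left (\<pi> x)) w" if "w \<in> W" for x w
    using that
  proof (induction x arbitrary: w rule: sidki_induct)
    case 1 show ?case by (simp add: \<pi>_def group_add_hom_simps[OF \<rho>(1)] sidki_zero_neg)
  next
    case (2 x g) then show ?case
      by (simp add: \<pi>_def group_add_hom_simps[OF \<rho>(1)] \<rho> sidki_left_add conjug_add W_conj)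
  next
    case (3 x g) then show ?case
      by (simp add: \<pi>_def group_add_hom_simps[OF \<rho>(1)] \<rho> sidki_left_add conjug_add W_conj lr)
  qed
  have "conjug x (conjug y w) = conjug y (conjug x w)" if "w \<in> W" for x y w
    using that pi[of "conjug y w" x] pi[of "conjug x w" y] pi[of w x] pi[of w y] ll[of w] by (simp add: W_conj)
  then show ?thesis using \<rho>(1) unfolding W_def by blast
qed

section \<open>Roots and conjugation\<close>

abbreviation ntimes :: "nat \<Rightarrow> 'h::monoid_add \<Rightarrow> 'h" where
  "ntimes n x \<equiv> sum_list (replicate n x)"

lemma ntimes_add: "ntimes (m + n) x = ntimes m x + ntimes n x"
  by (simp add: replicate_add)

lemma ntimes_mult: "ntimes (m * n) x = ntimes m (ntimes n x)"
  by (induction m) (simp_all add: ntimes_add)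

lemma conjug_ntimes: "conjug k (ntimes n w) = ntimes n (conjug k w)"
  by (induction n) (simp_all add: conjug_add_right)

lemma ntimes_inj:
  assumes tf: "torsion_free TYPE('h::group_add)" and x: "(x :: 'h) \<noteq> 0" and eq: "ntimes m x = ntimes n x"
  shows "m = n"
  using eq
proof (induction m n rule: linorder_wlog)
  case (le m n)
  then have "ntimes m x + ntimes (n - m) x = ntimes m x + 0" unfolding ntimes_add[symmetric] by simp
  then have "ntimes (n - m) x = 0" by (simp only: add_left_cancel)
  then show ?case using tf x le(1) unfolding torsion_free_def by (metis le_antisym not_le zero_less_diff)
qed simp

text \<open>
  With more exponents than equations, a pigeonhole count over a large box of exponents yields a
  coincidence; natural exponents on both sides replace one integral relation.
\<close>

lemma pigeonhole_exponents:
  fixes v :: "'i \<Rightarrow> 'b \<Rightarrow> nat"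
  assumes I: "finite I" and F: "finite F" and card: "card F < card I"
  shows "\<exists>e e'. (\<exists>i\<in>I. e i \<noteq> e' i) \<and> (\<forall>b\<in>F. (\<Sum>i\<in>I. e i * v i b) = (\<Sum>i\<in>I. e' i * v i b))"
proof -
  define B where "B = Suc (\<Sum>b\<in>F. \<Sum>i\<in>I. v i b)"
  \<comment> \<open>This choice gives \<open>(B * (M + 1)) ^ card F = M * (M + 1) ^ card F\<close>,
    so the values of \<open>\<phi>\<close> are fewer than the points of the box.\<close>
  define M where "M = B ^ card F"
  define E where "E = I \<rightarrow>\<^sub>E {..M}"
  define \<phi> where "\<phi> e = (\<lambda>b\<in>F. \<Sum>i\<in>I. e i * v i b)" for e
  have "\<phi> e \<in> F \<rightarrow>\<^sub>E {..B * M}" if e: "e \<in> E" for e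
  proof -
    have "(\<Sum>i\<in>I. e i * v i b) \<le> B * M" if "b \<in> F" for b
    proof -
      have "(\<Sum>i\<in>I. e i * v i b) \<le> (\<Sum>i\<in>I. M * v i b)"
        using e by (intro sum_mono mult_right_mono) (auto simp: E_def)
      also have "\<dots> = M * (\<Sum>i\<in>I. v i b)" by (simp add: sum_distrib_left)
      also have "(\<Sum>i\<in>I. v i b) \<le> B"
        unfolding B_def using member_le_sum[OF that, of "\<lambda>b. \<Sum>i\<in>I. v i b"] F by simp
      finally show ?thesis by (simp add: mult.commute)
    qed
    then show ?thesis by (auto simp: \<phi>_def)
  qed
  then have "card (\<phi> ` E) \<le> card (F \<rightarrow>\<^sub>E {..B * M})"
    using F by (intro card_mono finite_PiE) auto
  also have "\<dots> = (B * M + 1) ^ card F" using F by (simp add: card_PiE)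
  also have "\<dots> \<le> (B * (M + 1)) ^ card F" by (intro power_mono) (simp_all add: B_def)
  also have "\<dots> = M * (M + 1) ^ card F" by (simp only: M_def power_mult_distrib)
  also have "\<dots> < (M + 1) ^ Suc (card F)" by simp
  also have "\<dots> \<le> (M + 1) ^ card I" using card by (intro power_increasing) auto
  also have "\<dots> = card E" using I by (simp add: E_def card_PiE)
  finally have "\<not> inj_on \<phi> E" by (rule pigeonhole)
  then obtain e e' where e: "e \<in> E" "e' \<in> E" "\<phi> e = \<phi> e'" "e \<noteq> e'" by (auto simp: inj_on_def)
  have "\<exists>i\<in>I. e i \<noteq> e' i" using e PiE_ext unfolding E_def by metis
  moreover have "(\<Sum>i\<in>I. e i * v i b) = (\<Sum>i\<in>I. e' i * v i b)" if "b \<in> F" for b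
    using fun_cong[OF e(3), of b] that by (simp add: \<phi>_def)
  ultimately show ?thesis by blast
qed

lemma conjug_mset_eq:
  fixes W :: "'h::group_add set"
  assumes W: "\<And>x w. w \<in> W \<Longrightarrow> conjug x w \<in> W"
    and comm: "\<And>x y w. w \<in> W \<Longrightarrow> conjug x (conjug y w) = conjug y (conjug x w)"
    and w: "w \<in> W" and eq: "mset xs = mset ys"
  shows "conjug (sum_list xs) w = conjug (sum_list ys) w"
proof -
  \<comment> \<open>Extension by the identity outside \<open>W\<close> makes these maps commute
    everywhere, as \<open>fold_multiset_equiv\<close> requires.\<close>
  define f where "f x v = (if v \<in> W then conjug x v else v)" for x v
  have "fold f xs v = conjug (sum_list (rev xs)) v" if "v \<in> W" for xs v
    using that by (induction xs arbitrary: v) (simp_all add: f_def W conjug_add)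
  from this[OF w, of "rev xs"] this[OF w, of "rev ys"]
  have "conjug (sum_list xs) w = fold f (rev xs) w" "conjug (sum_list ys) w = fold f (rev ys) w"
    by simp_all
  moreover have "fold f (rev xs) = fold f (rev ys)"
    by (rule fold_multiset_equiv) (auto simp: f_def fun_eq_iff W comm eq)
  ultimately show ?thesis by simp
qed

lemma conjug_concat_powers:
  assumes "\<And>p. p \<in> set ps \<Longrightarrow> conjug (sum_list (u p)) w = ntimes (N p) w"
  shows "conjug (sum_list (concat (map (\<lambda>p. concat (replicate (e p) (u p))) ps))) w =
    ntimes (\<Prod>p\<leftarrow>ps. N p ^ e p) w"
  using assms
proof (induction ps)
  case (Cons p ps)
  have "conjug (sum_list (concat (replicate k (u p)))) w = ntimes (N p ^ k) w" for k
    by (induction k) (simp_all add: conjug_add conjug_ntimes Cons.prems flip: ntimes_mult, simp add: mult.commute)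
  then show ?case using Cons by (simp add: conjug_add conjug_ntimes flip: ntimes_mult) (simp add: mult.commute)
qed simp

text \<open>
  Conjugation by words over \<open>F\<close> acts on \<open>W\<close> through an abelian group of rank at most \<open>card F\<close>,
  while prime powers are multiplicatively independent.
\<close>

lemma card_prime_power_conjugations:
  fixes W :: "'h::group_add set"
  assumes tf: "torsion_free TYPE('h)"
    and W: "\<And>x w. w \<in> W \<Longrightarrow> conjug x w \<in> W"
    and comm: "\<And>x y w. w \<in> W \<Longrightarrow> conjug x (conjug y w) = conjug y (conjug x w)"
    and w: "w \<in> W" "w \<noteq> 0" and F: "finite F"
    and P: "finite P" "\<And>p. p \<in> P \<Longrightarrow> prime p" "\<And>p. p \<in> P \<Longrightarrow> 0 < n p"
    and u: "\<And>p. p \<in> P \<Longrightarrow> set (u p) \<subseteq> F"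
      "\<And>p. p \<in> P \<Longrightarrow> conjug (sum_list (u p)) w = ntimes (p ^ n p) w"
  shows "card P \<le> card F"
proof (rule ccontr)
  assume "\<not> card P \<le> card F"
  then obtain e e' where e: "\<exists>p\<in>P. e p \<noteq> e' p"
    "\<And>b. b \<in> F \<Longrightarrow> (\<Sum>p\<in>P. e p * count_list (u p) b) = (\<Sum>p\<in>P. e' p * count_list (u p) b)"
    using pigeonhole_exponents[OF P(1) F, of "\<lambda>p. count_list (u p)"] by auto
  obtain ps where ps: "set ps = P" "distinct ps" using finite_distinct_list[OF P(1)] by blast
  \<comment> \<open>Taking \<open>e p\<close> copies of each \<open>u p\<close> or
    \<open>e' p\<close> copies gives the same number of every letter, so the two words act alike on
    \<open>w\<close>.\<close>
  define word where "word e = concat (map (\<lambda>p. concat (replicate (e p) (u p))) ps)" for e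
  have cnt_rep: "count_list (concat (replicate k xs)) b = k * count_list xs b" for k and xs :: "'h list" and b
    by (induction k) simp_all
  have "count_list (concat (map (\<lambda>p. concat (replicate (e p) (u p))) qs)) b =
      (\<Sum>p\<leftarrow>qs. e p * count_list (u p) b)" for e qs b
    by (induction qs) (simp_all add: cnt_rep)
  then have cnt: "count_list (word e) b = (\<Sum>p\<in>P. e p * count_list (u p) b)" for e b
    using ps by (simp add: word_def sum_list_distinct_conv_sum_set)
  have "count_list (word e) b = count_list (word e') b" for b
  proof (cases "b \<in> F")
    case False
    then have "count_list (u p) b = 0" if "p \<in> P" for p using u(1)[OF that] by (auto intro: count_notin)
    then show ?thesis by (simp add: cnt)
  qed (simp add: cnt e(2))
  then have "mset (word e) = mset (word e')" by (intro multiset_eqI) (simp add: count_mset)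
  then have "conjug (sum_list (word e)) w = conjug (sum_list (word e')) w"
    using W comm w(1) by (intro conjug_mset_eq[of W]) auto
  moreover have "conjug (sum_list (word e)) w = ntimes (\<Prod>p\<in>P. p ^ (n p * e p)) w" for e
    unfolding word_def using conjug_concat_powers[of ps u w "\<lambda>p. p ^ n p" e] ps u(2)
    by (simp add: prod.distinct_set_conv_list[OF ps(2), symmetric] power_mult)
  \<comment> \<open>Torsion-freeness recovers the multiplier from the multiple of \<open>w\<close>;
    unique factorization then compares exponents.\<close>
  ultimately have eq: "(\<Prod>p\<in>P. p ^ (n p * e p)) = (\<Prod>p\<in>P. p ^ (n p * e' p))"
    using ntimes_inj[OF tf w(2)] by simp
  obtain p where p: "p \<in> P" "e p \<noteq> e' p" using e(1) by blast
  then have "n p * e p = n p * e' p"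
    using multiplicity_prod_prime_powers[of P p "\<lambda>p. n p * e p"]
      multiplicity_prod_prime_powers[of P p "\<lambda>p. n p * e' p"] P eq by simp
  then show False using p P(3)[OF p(1)] by simp
qed

section \<open>Conjugacy under a finitely generated subgroup\<close>

definition generated :: "'h::monoid_add set \<Rightarrow> 'h set" where
  "generated F = sum_list ` lists F"

lemma generated_closed:
  fixes F :: "'h::group_add set"
  shows "0 \<in> generated F" "x \<in> F \<Longrightarrow> x \<in> generated F"
    "x \<in> generated F \<Longrightarrow> y \<in> generated F \<Longrightarrow> x + y \<in> generated F"
proof -
  show "0 \<in> generated F" unfolding generated_def by (rule image_eqI[of _ _ "[]"]) auto
  show "x \<in> F \<Longrightarrow> x \<in> generated F" unfolding generated_def by (rule image_eqI[of _ _ "[x]"]) auto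
  show "x + y \<in> generated F" if "x \<in> generated F" "y \<in> generated F"
  proof -
    obtain xs ys where "xs \<in> lists F" "ys \<in> lists F" "x = sum_list xs" "y = sum_list ys"
      using \<open>x \<in> generated F\<close> \<open>y \<in> generated F\<close> unfolding generated_def by blast
    then show ?thesis unfolding generated_def by (intro image_eqI[of _ _ "xs @ ys"]) auto
  qed
qed

text \<open>Words carry no formal inverses, so \<open>F\<close> must be closed under inverses for
  \<open>generated F\<close> to be a subgroup.\<close>

lemma generated_uminus:
  fixes F :: "'h::group_add set"
  assumes "\<And>x. x \<in> F \<Longrightarrow> - x \<in> F" and "x \<in> generated F"
  shows "- x \<in> generated F"
proof -
  have "- sum_list xs \<in> generated F" if "xs \<in> lists F" for xs
    using that
    by (induction xs) (simp_all add: generated_closed minus_add assms(1) del: add_uminus_conv_diff)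
  then show ?thesis using assms(2) by (auto simp: generated_def)
qed

definition conj_class :: "'h::group_add set \<Rightarrow> 'h \<Rightarrow> 'h set" where
  "conj_class K w = (\<lambda>k. conjug k w) ` K"

lemma conj_class_generated_eq:
  fixes F :: "'h::group_add set"
  assumes F: "\<And>x. x \<in> F \<Longrightarrow> - x \<in> F"
  shows "conj_class (generated F) x = conj_class (generated F) y \<longleftrightarrow> x \<in> conj_class (generated F) y"
proof -
  let ?K = "generated F"
  have self: "z \<in> conj_class ?K z" for z
    unfolding conj_class_def using generated_closed(1) by (rule rev_image_eqI) simp
  have sub: "conj_class ?K x \<subseteq> conj_class ?K y" if x: "x \<in> conj_class ?K y" for x y
  proof
    fix z assume "z \<in> conj_class ?K x"
    then obtain k l where "k \<in> ?K" "l \<in> ?K" "z = conjug (k + l) y"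
      using x by (auto simp: conj_class_def conjug_add)
    then show "z \<in> conj_class ?K y" unfolding conj_class_def by (blast intro: generated_closed)
  qed
  have sym: "y \<in> conj_class ?K x" if x: "x \<in> conj_class ?K y" for x y
  proof -
    obtain k where k: "k \<in> ?K" "x = conjug k y" using x by (auto simp: conj_class_def)
    then have "y = conjug (- k) x" by simp
    then show ?thesis using generated_uminus[OF F k(1)] unfolding conj_class_def by blast
  qed
  show ?thesis using self sub sym by blast
qed

text \<open>If the trace were nonzero, every prime \<open>p\<close> outside a finite set would yield
  a word over \<open>F\<close> conjugating \<open>w\<close> to a \<open>p ^ n\<close>-fold multiple
  with \<open>n > 0\<close>; at most \<open>card F\<close> primes can do so.\<close>

lemma class_trace_eq_0:
  fixes a :: "nat \<Rightarrow> nat \<Rightarrow> 'h::group_add \<Rightarrow> 'a::{idom, ring_char_0}" and W :: "'h set"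
  assumes F: "finite F" "\<And>i j g. i < n \<Longrightarrow> j < n \<Longrightarrow> g \<notin> F \<Longrightarrow> a i j g = 0"
    and F_uminus: "\<And>x. x \<in> F \<Longrightarrow> - x \<in> F"
    and idem: "\<And>i j g. i < n \<Longrightarrow> j < n \<Longrightarrow> a i j g = (\<Sum>k<n. \<Sum>h\<in>F. a i k h * a k j (- h + g))"
    and tf: "torsion_free TYPE('h)"
    and W: "\<And>x w. w \<in> W \<Longrightarrow> conjug x w \<in> W"
    and comm: "\<And>x y w. w \<in> W \<Longrightarrow> conjug x (conjug y w) = conjug y (conjug x w)"
    and w: "w \<in> W" "w \<noteq> 0"
  shows "(\<Sum>i<n. \<Sum>g\<in>conj_class (generated F) w \<inter> F. a i i g) = 0" (is "?b = 0")
proof (rule ccontr)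
  assume b0: "?b \<noteq> 0"
  define c where "c = conj_class (generated F) w"
  define E where "E = insert 0 ((\<lambda>(i, j, g). a i j g) ` ({..<n} \<times> {..<n} \<times> F))"
  have "finite E" using F(1) by (simp add: E_def)
  then obtain S where S: "is_subring S" "E \<subseteq> S" "\<And>x. x \<in> S \<Longrightarrow> x \<noteq> 0 \<Longrightarrow> finite (nilp_primes S x)"
    using finitely_generated_subring_nilp_primes[of E] by blast
  have aS: "a i j g \<in> S" if "i < n" "j < n" for i j g
  proof (cases "g \<in> F")
    case True
    then have "(\<lambda>(i, j, g). a i j g) (i, j, g) \<in> E" using that unfolding E_def by (intro insertI2 imageI) simp
    then show ?thesis using S(2) by auto
  next
    case False
    then show ?thesis using F(2) that is_subringD(2)[OF S(1)] by simp
  qed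
  then have "?b \<in> S" by (intro is_subring_sum[OF S(1)]) simp
  then have fin: "finite (nilp_primes S ?b)" using S(3) b0 by blast
  have c_conjug: "conjug k h \<in> c" if "k \<in> generated F" "h \<in> c" for k h
  proof -
    obtain l where "l \<in> generated F" "h = conjug l w" using \<open>h \<in> c\<close> by (auto simp: c_def conj_class_def)
    then have "k + l \<in> generated F" "conjug k h = conjug (k + l) w"
      using that(1) by (simp_all add: conjug_add generated_closed)
    then show ?thesis unfolding c_def conj_class_def by blast
  qed
  have c_comm: "g + h \<in> c \<longleftrightarrow> h + g \<in> c" if "g \<in> F" for g h
  proof -
    have "g + h = conjug g (h + g)" "h + g = conjug (- g) (g + h)"
      by (simp_all add: conjug_def group_word del: add_uminus_conv_diff)
    then show ?thesis using c_conjug F_uminus that generated_closed(2) by metis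
  qed
  have ex: "\<exists>u n. set u \<subseteq> F \<and> 0 < n \<and> conjug (sum_list u) w = ntimes (p ^ n) w"
    if p: "prime p" "p \<notin> nilp_primes S ?b" for p
  proof -
    \<comment> \<open>Otherwise \<open>p\<close> divides \<open>?b\<close> in \<open>S\<close>, the
      case \<open>k = 1\<close> in \<open>nilp_primes\<close>.\<close>
    have "\<exists>g\<in>F. ntimes (p ^ m) g \<in> c" for m
    proof (rule ccontr)
      assume "\<not> ?thesis"
      then obtain s where "s \<in> S" "?b = of_nat p * s"
        using idempotent_class_trace_divisible[of F n a, OF F idem S(1) aS c_comm p(1)] unfolding c_def by blast
      then have "\<exists>s\<in>S. ?b ^ 1 = of_nat p * s" by (simp only: power_one_right) blast
      then show False using p unfolding nilp_primes_def by blast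
    qed
    then obtain g where g: "\<And>m. g m \<in> F" "\<And>m. ntimes (p ^ m) (g m) \<in> c" by metis
    \<comment> \<open>\<open>F\<close> is finite, so one element serves two exponents; its two
      multiples, both conjugate to \<open>w\<close>, differ by the factor
      \<open>p ^ (m' - m)\<close>.\<close>
    have "\<not> inj g" using g(1) F(1) by (metis finite_subset image_subsetI infinite_UNIV_nat range_inj_infinite)
    then obtain m m' where m: "m < m'" "g m = g m'" by (metis injI linorder_neqE_nat)
    obtain k k' where k: "k \<in> generated F" "ntimes (p ^ m) (g m) = conjug k w"
      "k' \<in> generated F" "ntimes (p ^ m') (g m') = conjug k' w"
      using g(2)[of m] g(2)[of m'] by (auto simp: c_def conj_class_def)
    have "p ^ m' = p ^ (m' - m) * p ^ m" using m(1) by (simp flip: power_add)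
    then have "conjug k' w = conjug k (ntimes (p ^ (m' - m)) w)"
      using k m(2) by (simp add: ntimes_mult conjug_ntimes)
    then have "conjug (- k + k') w = ntimes (p ^ (m' - m)) w" by (simp add: conjug_add)
    moreover have "- k + k' \<in> generated F"
      using k generated_uminus[of F k] F_uminus by (blast intro: generated_closed(3))
    ultimately show ?thesis using m(1) unfolding generated_def by (metis imageE in_lists_conv_set subsetI zero_less_diff)
  qed
  have "infinite ({p::nat. prime p} - nilp_primes S ?b)"
    using primes_infinite fin by (rule Diff_infinite_finite[rotated])
  from infinite_arbitrarily_large[OF this, of "Suc (card F)"]
  obtain P where P: "finite P" "card P = Suc (card F)" "P \<subseteq> {p. prime p} - nilp_primes S ?b"
    by (elim exE conjE)
  have "\<forall>p\<in>P. \<exists>u n. set u \<subseteq> F \<and> 0 < n \<and> conjug (sum_list u) w = ntimes (p ^ n) w"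
    using P(3) ex by blast
  then obtain u n where "\<forall>p\<in>P. set (u p) \<subseteq> F \<and> 0 < n p \<and> conjug (sum_list (u p)) w = ntimes (p ^ n p) w"
    by metis
  then have "card P \<le> card F"
    using P by (intro card_prime_power_conjugations[OF tf W comm w F(1), where n = n and u = u]) auto
  then show False using P(2) by simp
qed

text \<open>Since \<open>W\<close> is closed under conjugation, the class of a nonzero element stays
  in \<open>W - {0}\<close>, and the sum splits into complete class traces.\<close>

lemma trace_on_normal_subset_eq_0:
  fixes a :: "nat \<Rightarrow> nat \<Rightarrow> 'h::group_add \<Rightarrow> 'a::{idom, ring_char_0}" and W :: "'h set"
  assumes F: "finite F" "\<And>i j g. i < n \<Longrightarrow> j < n \<Longrightarrow> g \<notin> F \<Longrightarrow> a i j g = 0"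
    and F_uminus: "\<And>x. x \<in> F \<Longrightarrow> - x \<in> F"
    and idem: "\<And>i j g. i < n \<Longrightarrow> j < n \<Longrightarrow> a i j g = (\<Sum>k<n. \<Sum>h\<in>F. a i k h * a k j (- h + g))"
    and tf: "torsion_free TYPE('h)"
    and W: "\<And>x w. w \<in> W \<Longrightarrow> conjug x w \<in> W"
    and comm: "\<And>x y w. w \<in> W \<Longrightarrow> conjug x (conjug y w) = conjug y (conjug x w)"
  shows "(\<Sum>g\<in>F \<inter> W - {0}. \<Sum>i<n. a i i g) = 0"
proof -
  define V where "V = F \<inter> W - {0}"
  define cls where "cls = conj_class (generated F)"
  note cls_eq = conj_class_generated_eq[OF F_uminus, folded cls_def]
  have cls_V: "h \<in> W - {0}" if "h \<in> cls w" "w \<in> V" for h w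
  proof -
    obtain k where "h = conjug k w" using \<open>h \<in> cls w\<close> by (auto simp: cls_def conj_class_def)
    then show ?thesis using that(2) W by (auto simp: V_def) (metis conjug_0(2) conjug_conjug_minus(2))
  qed
  have "(\<Sum>g\<in>V. \<Sum>i<n. a i i g) = (\<Sum>C\<in>cls ` V. \<Sum>g\<in>{g \<in> V. cls g = C}. \<Sum>i<n. a i i g)"
    using F(1) by (intro sum.group[symmetric]) (auto simp: V_def)
  also have "\<dots> = (\<Sum>C\<in>cls ` V. 0)"
  proof (rule sum.cong[OF HOL.refl])
    fix C assume "C \<in> cls ` V"
    then obtain w where w: "w \<in> V" "C = cls w" by blast
    have "{g \<in> V. cls g = C} = C \<inter> F" using cls_V w by (auto simp: cls_eq V_def)
    then have "(\<Sum>g\<in>{g \<in> V. cls g = C}. \<Sum>i<n. a i i g) = (\<Sum>i<n. \<Sum>g\<in>C \<inter> F. a i i g)"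
      by (simp add: sum.swap[of _ "C \<inter> F"])
    also have "\<dots> = 0" unfolding w(2) cls_def
      using w(1) by (intro class_trace_eq_0[OF F F_uminus idem tf W comm]) (auto simp: V_def)
    finally show "(\<Sum>g\<in>{g \<in> V. cls g = C}. \<Sum>i<n. a i i g) = 0" .
  qed
  finally show ?thesis by (simp add: V_def)
qed

section \<open>Descent along homomorphisms\<close>

abbreviation "lookup \<equiv> Poly_Mapping.lookup"
abbreviation "keys \<equiv> Poly_Mapping.keys"

definition pushforward :: "('h \<Rightarrow> 'k) \<Rightarrow> ('h \<Rightarrow>\<^sub>0 'a::comm_monoid_add) \<Rightarrow> ('k \<Rightarrow>\<^sub>0 'a)" where
  "pushforward f a = (\<Sum>x\<in>keys a. Poly_Mapping.single (f x) (lookup a x))"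

lemma pushforward_superset:
  assumes "finite X" "keys a \<subseteq> X"
  shows "pushforward f a = (\<Sum>x\<in>X. Poly_Mapping.single (f x) (lookup a x))"
  unfolding pushforward_def using assms by (intro sum.mono_neutral_left) (auto simp: in_keys_iff)

lemma pushforward_0 [simp]: "pushforward f 0 = 0"
  by (simp add: pushforward_def)

lemma pushforward_add: "pushforward f (a + b) = pushforward f a + pushforward f b"
proof -
  let ?X = "keys a \<union> keys b"
  have "pushforward f c = (\<Sum>x\<in>?X. Poly_Mapping.single (f x) (lookup c x))"
    if "c \<in> {a, b, a + b}" for c
    using that keys_add[of a b] by (intro pushforward_superset) auto
  then show ?thesis by (simp add: lookup_add single_add sum.distrib)
qed

lemma pushforward_sum: "pushforward f (\<Sum>i\<in>I. a i) = (\<Sum>i\<in>I. pushforward f (a i))"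
  by (induction I rule: infinite_finite_induct) (simp_all add: pushforward_add)

lemma pushforward_single [simp]:
  "pushforward f (Poly_Mapping.single x c) = Poly_Mapping.single (f x) c"
  by (subst pushforward_superset[of "{x}"]) simp_all

lemma poly_mapping_sum_singles: "(\<Sum>x\<in>keys a. Poly_Mapping.single x (lookup a x)) = a"
  by (rule poly_mapping_eqI) (simp add: lookup_sum lookup_single when_def in_keys_iff)

lemma pushforward_mult:
  fixes a b :: "'h::group_add \<Rightarrow>\<^sub>0 'a::semiring_0" and f :: "'h \<Rightarrow> 'k::group_add"
  assumes "group_add_hom f"
  shows "pushforward f (a * b) = pushforward f a * pushforward f b"
proof -
  interpret group_add_hom f by fact
  have "a * b = (\<Sum>x\<in>keys a. \<Sum>y\<in>keys b.
      Poly_Mapping.single (x + y) (lookup a x * lookup b y))"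
    unfolding mult_single[symmetric] sum_product[symmetric] poly_mapping_sum_singles ..
  then show ?thesis
    by (simp add: pushforward_sum hom_add) (simp add: pushforward_def sum_product mult_single)
qed

lemma semiring_hom_pushforward:
  assumes "group_add_hom f"
  shows "semiring_hom (pushforward f :: ('h::group_add \<Rightarrow>\<^sub>0 'a::semiring_1) \<Rightarrow> ('k::group_add \<Rightarrow>\<^sub>0 'a))"
proof -
  interpret group_add_hom f by fact
  show ?thesis
    by unfold_locales (simp_all add: pushforward_add pushforward_mult assms flip: single_one)
qed

lemma lookup_pushforward:
  "lookup (pushforward f a) y = (\<Sum>x\<in>keys a. if f x = y then lookup a x else 0)"
  by (simp add: pushforward_def lookup_sum lookup_single when_def)

lemma Sum_any_lookup_superset:
  assumes "finite X" "keys a \<subseteq> X"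
  shows "Sum_any (lookup a) = (\<Sum>x\<in>X. lookup a x)"
  using assms by (intro Sum_any.expand_superset) (auto simp: in_keys_iff)

lemma Sum_any_lookup_pushforward:
  "Sum_any (lookup (pushforward f a)) = Sum_any (lookup a)"
proof -
  have "keys (pushforward f a) \<subseteq> f ` keys a"
  proof
    fix y assume "y \<in> keys (pushforward f a)"
    then have "(\<Sum>x\<in>keys a. if f x = y then lookup a x else 0) \<noteq> 0"
      by (simp add: in_keys_iff lookup_pushforward)
    then obtain x where "x \<in> keys a" "(if f x = y then lookup a x else 0) \<noteq> 0"
      by (rule sum.not_neutral_contains_not_neutral)
    then have "x \<in> keys a" "f x = y" by (simp_all split: if_splits)
    then show "y \<in> f ` keys a" by blast
  qed
  then have "Sum_any (lookup (pushforward f a)) =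
      (\<Sum>y\<in>f ` keys a. \<Sum>x\<in>keys a. if f x = y then lookup a x else 0)"
    by (subst Sum_any_lookup_superset[of "f ` keys a"]) (simp_all add: lookup_pushforward)
  also have "\<dots> = (\<Sum>x\<in>keys a. \<Sum>y\<in>f ` keys a. if f x = y then lookup a x else 0)"
    by (rule sum.swap)
  also have "\<dots> = (\<Sum>x\<in>keys a. lookup a x)" by (intro sum.cong) simp_all
  finally show ?thesis by (simp add: Sum_any_lookup_superset[of "keys a"])
qed

lemma lookup_mult_group:
  fixes a b :: "'h::group_add \<Rightarrow>\<^sub>0 'a::semiring_0"
  assumes "finite X" "keys a \<subseteq> X"
  shows "lookup (a * b) g =
    (\<Sum>x\<in>X. lookup a x * lookup b (- x + g))"
proof -
  have eq: "g = x + y \<longleftrightarrow> y = - x + g" for x y by (metis add_minus_cancel minus_add_cancel)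
  have "(\<Sum>y. lookup b y when g = x + y) = lookup b (- x + g)" for x
    unfolding eq when_def by simp
  then have "lookup (a * b) g =
      (\<Sum>x. lookup a x * lookup b (- x + g))" by (simp add: lookup_mult)
  also have "\<dots> = (\<Sum>x\<in>X. lookup a x * lookup b (- x + g))"
  proof (rule Sum_any.expand_superset[OF assms(1)])
    have zero: "lookup a x = 0" if "x \<notin> X" for x using assms(2) that by (auto simp: in_keys_iff)
    show "{x. lookup a x * lookup b (- x + g) \<noteq> 0} \<subseteq> X"
      by (rule subsetI, rule ccontr) (simp add: zero)
  qed
  finally show ?thesis .
qed

definition mat_trace :: "'a::comm_monoid_add mat \<Rightarrow> 'a" where
  "mat_trace A = (\<Sum>i<dim_row A. A $$ (i, i))"

text \<open>Both traces are functionals of one group ring element, so only its coefficients have to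
  be followed under \<open>pushforward\<close>.\<close>

lemma traces_eq_mat_trace:
  "kaplansky_trace A = lookup (mat_trace A) 0"
  "augmentation_trace A = Sum_any (lookup (mat_trace A))"
  by (simp_all add: kaplansky_trace_def augmentation_trace_def mat_trace_def lookup_sum fun_eq_iff)

lemma mat_trace_pushforward:
  "A \<in> carrier_mat n n \<Longrightarrow> mat_trace (map_mat (pushforward f) A) = pushforward f (mat_trace A)"
  by (auto simp: mat_trace_def pushforward_sum intro!: sum.cong)

text \<open>Augmentation is unchanged by \<open>f\<close>, whereas the Kaplansky trace of the image
  collects the coefficients over the kernel. The hypothesis on \<open>'k\<close> equates the two,
  and the part of the kernel sum away from 0 vanishes.\<close>

lemma weak_bass_from_quotient:
  fixes f :: "'h::group_add \<Rightarrow> 'k::group_add"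
  assumes f: "group_add_hom f" and tf: "torsion_free TYPE('h)" and wb: "weak_bass TYPE('k)"
    and comm: "\<And>x y w. f w = 0 \<Longrightarrow> conjug x (conjug y w) = conjug y (conjug x w)"
  shows "weak_bass TYPE('h)"
  unfolding weak_bass_def
proof (intro allI impI ballI)
  fix n :: nat and A :: "('h \<Rightarrow>\<^sub>0 complex) mat"
  assume n: "1 \<le> n" and A: "A \<in> carrier_mat n n" and idem: "A * A = A"
  interpret f: group_add_hom f by fact
  interpret pf: semiring_hom "pushforward f :: ('h \<Rightarrow>\<^sub>0 complex) \<Rightarrow> _"
    by (rule semiring_hom_pushforward[OF f])
  define W where "W = {w. f w = 0}"
  have W: "conjug x w \<in> W" if "w \<in> W" for x w
    using that by (simp add: W_def conjug_def f.hom_add f.hom_uminus del: add_uminus_conv_diff)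
  define a where "a i j = lookup (A $$ (i, j))" for i j
  define F0 where "F0 = (\<Union>i<n. \<Union>j<n. keys (A $$ (i, j)))"
  \<comment> \<open>\<open>0\<close> is included so that its term can be split off later; the
    negatives make \<open>generated F\<close> a subgroup.\<close>
  define F where "F = insert 0 (F0 \<union> uminus ` F0)"
  have finF: "finite F" by (auto simp: F_def F0_def)
  have keys_F: "keys (A $$ (i, j)) \<subseteq> F" if "i < n" "j < n" for i j
    using that by (auto simp: F_def F0_def)
  have a0: "a i j g = 0" if "i < n" "j < n" "g \<notin> F" for i j g
    using keys_F[OF that(1,2)] that(3) by (auto simp: a_def in_keys_iff)
  have F_uminus: "- x \<in> F" if "x \<in> F" for x using that by (auto simp: F_def)
  have a_idem: "a i j g = (\<Sum>k<n. \<Sum>h\<in>F. a i k h * a k j (- h + g))" if "i < n" "j < n" for i j g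
  proof -
    have "A $$ (i, j) = (\<Sum>k<n. A $$ (i, k) * A $$ (k, j))"
      by (subst idem[symmetric]) (use A that in \<open>simp add: scalar_prod_def lessThan_atLeast0\<close>)
    then have "a i j g = (\<Sum>k<n. lookup (A $$ (i, k) * A $$ (k, j)) g)"
      by (simp add: a_def lookup_sum)
    also have "\<dots> = (\<Sum>k<n. \<Sum>h\<in>F. a i k h * a k j (- h + g))"
      unfolding a_def using finF keys_F that by (intro sum.cong lookup_mult_group) auto
    finally show ?thesis .
  qed
  define t where "t = mat_trace A"
  have t: "lookup t g = (\<Sum>i<n. a i i g)" for g
    using A by (simp add: t_def mat_trace_def lookup_sum a_def)
  have keys_t: "keys t \<subseteq> F"
  proof
    fix g assume "g \<in> keys t"
    then have "(\<Sum>i<n. a i i g) \<noteq> 0" by (simp add: in_keys_iff t)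
    then show "g \<in> F" by (rule contrapos_np) (simp add: a0)
  qed
  have "kaplansky_trace (map_mat (pushforward f) A) = augmentation_trace (map_mat (pushforward f) A)"
  proof -
    have "map_mat (pushforward f) A * map_mat (pushforward f) A = map_mat (pushforward f) A"
      using pf.mat_hom_mult[OF A A] idem by simp
    then show ?thesis using wb n A unfolding weak_bass_def by auto
  qed
  then have "Sum_any (lookup t) = lookup (pushforward f t) 0"
    by (simp add: traces_eq_mat_trace mat_trace_pushforward[OF A] t_def Sum_any_lookup_pushforward)
  also have "\<dots> = (\<Sum>x\<in>F. if f x = 0 then lookup t x else 0)"
    unfolding lookup_pushforward using finF keys_t by (intro sum.mono_neutral_left) (auto simp: in_keys_iff)
  also have "\<dots> = (\<Sum>x\<in>F \<inter> W. lookup t x)"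
    using finF by (simp add: sum.inter_filter W_def Int_def)
  also have "\<dots> = lookup t 0 + (\<Sum>x\<in>F \<inter> W - {0}. lookup t x)"
    using finF by (intro sum.remove) (auto simp: F_def W_def f.hom_zero)
  also have "(\<Sum>x\<in>F \<inter> W - {0}. lookup t x) = 0"
    unfolding t
    by (rule trace_on_normal_subset_eq_0[OF finF a0 F_uminus a_idem tf W]) (use comm in \<open>simp_all add: W_def\<close>)
  finally show "kaplansky_trace A = augmentation_trace A"
    by (simp add: traces_eq_mat_trace t_def)
qed

theorem proposition3p1:
  assumes "torsion_free TYPE('g::group_add sidki)"
    and "weak_bass TYPE('g \<times> 'g \<times> 'g)"
  shows "weak_bass TYPE('g sidki)"
proof -
  obtain \<rho> :: "'g sidki \<Rightarrow> 'g \<times> 'g \<times> 'g" where "group_add_hom \<rho>"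
    "\<And>w x y. \<rho> w = 0 \<Longrightarrow> conjug x (conjug y w) = conjug y (conjug x w)"
    using sidki_hom_to_triple by blast
  then show ?thesis using assms by (intro weak_bass_from_quotient[of \<rho>])
qed

end
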